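(* Let $\mathcal{V}\subset\operatorname{lsc-fcns}(\mathcal{X})$ satisfy the following regularity assumption: for each $V\in\mathcal{V}$ and $x\in\mathcal{X}$ the function $b(V)(x,\cdot)$ is integrable with respect to $\mathbb{P}$ and $B$ maps $\mathcal{V}$ into itself; moreover, for each $\nu\in\mathbb{N}$, for each $V\in\mathcal{V}$ and $x\in\mathcal{X}$ the function $b_\nu(V)(x,\cdot)$ is integrable with respect to $\mathbb{P}_\nu$ and $B_\nu$ maps $\mathcal{V}$ into itself. Suppose that $\mathbb{P}_\nu\Rightarrow\mathbb{P}$ (weak convergence), $\varphi_\nu\overset{\mathrm{e}}{\to}\varphi$, and $\varphi_\nu\overset{\mathrm{p}}{\to}\varphi$, and that $\mathcal{V}$ is closed under the Attouch--Wets distance $d\!\!l$. Further, suppose that every epi-convergent sequence $\{V_\nu\in\mathcal{V}\}_{\nu\in\mathbb{N}}$ is equi-lsc and satisfies the following conditions for each $\bar x\in\mathcal{X}$: (i) One has $$\liminf_{\tau\to-\infty}\ \liminf_{(\nu,x)\to(\infty,\bar x)}\ \mathbb{E}_{\mathbb{P}_\nu}\Bigl[b_\nu(V_\nu)(x,\boldsymbol{\xi})\,\mathbb{1}\bigl\{b_\nu(V_\nu)(x,\boldsymbol{\xi})\le\tau\bigr\}\Bigr]=0,$$ and $\{b_\nu(V_\nu)\}_{\nu\in\mathbb{N}}$ is a sequence of lsc functions on $\mathcal{X}\times\Xi$ that is equi-lsc. (ii) One has $$\limsup_{\tau\to\infty}\ \limsup_{\nu\to\infty}\ \mathbb{E}_{\mathbb{P}_\nu}\Bigl[b_\nu(V_\nu)(\bar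 x,\boldsymbol{\xi})\,\mathbb{1}\bigl\{b_\nu(V_\nu)(\bar x,\boldsymbol{\xi})\ge\tau\bigr\}\Bigr]=0,$$ and $\{b_\nu(V_\nu)(\bar x,\cdot)\}_{\nu\in\mathbb{N}}$ is a sequence of usc functions on $\Xi$ that is equi-usc. Then $$\operatorname{LimOut}\{V\in\mathcal{V}:V=B_\nu(V)\}\subset\{V\in\mathcal{V}:V=B(V)\}.$$ In addition, if $\mathcal{V}$ is compact under $d\!\!l$ and each $B_\nu$ has a fixed point $V_\nu=B_\nu(V_\nu)$ in $\mathcal{V}$, then every cluster point (with respect to $d\!\!l$) of $\{V_\nu\}_{\nu\in\mathbb{N}}$ is contained in $\{V\in\mathcal{V}:V=B(V)\}$, and this set is nonempty.
   Context: Setting. $\mathcal{X}\subset\mathbb{R}^n$ (state space) and $\Xi\subset\mathbb{R}^m$ (outcome space) are closed sets; $\beta\in(0,1)$; $\mathcal{Y}:\mathcal{X}\times\Xi\rightrightarrows\mathcal{X}$ is a set-valued mapping with nonempty compact values; $\varphi,\varphi_\nu:\mathcal{X}\times\mathcal{X}\times\Xi\to\mathbb{R}$ ($\nu\in\mathbb{N}$) are functions; $\mathbb{P},\mathbb{P}_\nu$ ($\nu\in\mathbb{N}$) are Borel probability distributions on $\Xi$. $\mathbb{E}_{\mathbb{P}}[f(\boldsymbol{\xi})]=\int_\Xi f(\xi)\,d\mathbb{P}(\xi)$, and $\mathbb{1}\{\mathcal{E}\}$ is $1$ if $\mathcal{E}$ is true and $0$ otherwise. Function classes. For a closed set $\mathcal{Z}\subset\mathbb{R}^r$,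 $\operatorname{fcns}(\mathcal{Z})$ is the set of functions $\mathcal{Z}\to[-\infty,\infty]$ other than the constant function $\infty$, and $\operatorname{lsc-fcns}(\mathcal{Z})$ is its subset of lower semicontinuous (lsc) functions; usc means upper semicontinuous. Bellman operators. For $f\in\operatorname{lsc-fcns}(\mathcal{X})$, $$b(f)(x,\xi)=\inf_{y\in\mathcal{Y}(x,\xi)}\{\varphi(x,y,\xi)+\beta f(y)\},\qquad B(f)(x)=\mathbb{E}_{\mathbb{P}}[b(f)(x,\boldsymbol{\xi})],$$ $$b_\nu(f)(x,\xi)=\inf_{y\in\mathcal{Y}(x,\xi)}\{\varphi_\nu(x,y,\xi)+\beta f(y)\},\qquad B_\nu(f)(x)=\mathbb{E}_{\mathbb{P}_\nu}[b_\nu(f)(x,\boldsymbol{\xi})].$$ Convergence. For $f,f_\nu\in\operatorname{fcns}(\mathcal{Z})$: $f_\nu\overset{\mathrm{p}}{\to}f$ means pointwise convergence; $f_\nu\overset{\mathrm{e}}{\to}f$ (epi-convergence) means that for each $z\in\mathcal{Z}$, every sequence $z_\nu\in\mathcal{Z}\to z$ satisfies $\liminf f_\nu(z_\nu)\ge f(z)$, and some sequence $z_\nu\in\mathcal{Z}\to z$ satisfies $\limsup f_\nu(z_\nu)\le f(z)$. Equi-semicontinuity. A sequence $f_\nu\in\operatorname{lsc-fcns}(\mathcal{Z})$ is equi-lsc if for every $\bar z\in\mathcal{Z}$ either $f_\nu(\bar z)\to-\infty$, or for each $\rho,\varepsilon\in(0,\infty)$ there exist $\bar\nu\in\mathbb{N}$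 and $\delta>0$ such that $\inf_{z\in\mathcal{Z},\|z-\bar z\|_2\le\delta}f_\nu(z)\ge\min\{f_\nu(\bar z)-\varepsilon,\rho\}$ for all $\nu\ge\bar\nu$. A sequence of usc functions $f_\nu$ is equi-usc if $\{-f_\nu\}$ is equi-lsc. Attouch--Wets distance. Fix $z_{\mathrm{ctr}}\in\mathcal{X}\times\mathbb{R}$. For $f,g\in\operatorname{lsc-fcns}(\mathcal{X})$, $$d\!\!l(f,g)=\int_0^\infty\max_{z\in\mathcal{X}\times\mathbb{R},\,\|z-z_{\mathrm{ctr}}\|_2\le\rho}\bigl|\operatorname{dist}(z,\operatorname{epi}f)-\operatorname{dist}(z,\operatorname{epi}g)\bigr|\,e^{-\rho}\,d\rho,$$ where $\operatorname{epi}f=\{(x,\tau)\in\mathcal{X}\times\mathbb{R}:f(x)\le\tau\}$ and $\operatorname{dist}$ is the Euclidean point-to-set distance. This is a metric on $\operatorname{lsc-fcns}(\mathcal{X})$ and $f_\nu\overset{\mathrm{e}}{\to}f$ if and only if $d\!\!l(f_\nu,f)\to0$. The expression $V=B(V)$ means $d\!\!l(V,B(V))=0$, equivalently pointwise equality on $\mathcal{X}$. The limit $(\nu,x)\to(\infty,\bar x)$ means $\nu\to\infty$ in $\mathbb{N}$ and $x\to\bar x$ with $x\in\mathcal{X}$. For sets $S_\nu$ in a metric space (here $(\mathcal{V},d\!\!l)$), $\operatorname{LimOut}(S_\nu)$ is the set of all $z$ for which there are a subsequence $\nu_1<\nu_2<\cdots$ and $z_\kappa\in S_{\nu_\kappa}$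 with $z_\kappa\to z$. *)

theory Defs
  imports "HOL-Probability.Probability"
begin

section \<open>Extended-real-valued functions on a closed set\<close>

text \<open>
  A function on \<open>Z\<close> is represented by its extensional extension (\<open>undefined\<close> off \<open>Z\<close>), so that
  equality of such functions is pointwise equality on \<open>Z\<close>. The predicates \<open>lsc_on\<close>, \<open>epi_conv\<close>,
  \<open>equi_lsc\<close> etc. only look at values on \<open>Z\<close> and are also used for non-extensional representatives.
\<close>

definition fcns :: "'a set \<Rightarrow> ('a \<Rightarrow> ereal) set" where
  "fcns Z = {f \<in> extensional Z. \<not> (\<forall>z\<in>Z. f z = \<infinity>)}"

definition lsc_on :: "'a::topological_space set \<Rightarrow> ('a \<Rightarrow> ereal) \<Rightarrow> bool" where
  "lsc_on Z f \<longleftrightarrow> (\<forall>z\<in>Z. f z \<le> Liminf (at z within Z) f)"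

definition usc_on :: "'a::topological_space set \<Rightarrow> ('a \<Rightarrow> ereal) \<Rightarrow> bool" where
  "usc_on Z f \<longleftrightarrow> (\<forall>z\<in>Z. Limsup (at z within Z) f \<le> f z)"

definition lsc_fcns :: "'a::topological_space set \<Rightarrow> ('a \<Rightarrow> ereal) set" where
  "lsc_fcns Z = {f \<in> fcns Z. lsc_on Z f}"

definition epi_conv :: "'a::topological_space set \<Rightarrow> (nat \<Rightarrow> 'a \<Rightarrow> ereal) \<Rightarrow> ('a \<Rightarrow> ereal) \<Rightarrow> bool" where
  "epi_conv Z fs f \<longleftrightarrow> (\<forall>z\<in>Z.
     (\<forall>zs. (\<forall>\<nu>. zs \<nu> \<in> Z) \<and> zs \<longlonglongrightarrow> z \<longrightarrow> liminf (\<lambda>\<nu>. fs \<nu> (zs \<nu>)) \<ge> f z) \<and>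
     (\<exists>zs. (\<forall>\<nu>. zs \<nu> \<in> Z) \<and> zs \<longlonglongrightarrow> z \<and> limsup (\<lambda>\<nu>. fs \<nu> (zs \<nu>)) \<le> f z))"

definition equi_lsc :: "'a::metric_space set \<Rightarrow> (nat \<Rightarrow> 'a \<Rightarrow> ereal) \<Rightarrow> bool" where
  "equi_lsc Z fs \<longleftrightarrow> (\<forall>z0\<in>Z.
     ((\<lambda>\<nu>. fs \<nu> z0) \<longlonglongrightarrow> -\<infinity>) \<or>
     (\<forall>\<rho>>0. \<forall>\<epsilon>>0. \<exists>N. \<exists>\<delta>>0. \<forall>\<nu>\<ge>N.
        (INF z\<in>{z\<in>Z. dist z z0 \<le> \<delta>}. fs \<nu> z) \<ge> min (fs \<nu> z0 - ereal \<epsilon>) (ereal \<rho>)))"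

definition equi_usc :: "'a::metric_space set \<Rightarrow> (nat \<Rightarrow> 'a \<Rightarrow> ereal) \<Rightarrow> bool" where
  "equi_usc Z fs \<longleftrightarrow> equi_lsc Z (\<lambda>\<nu> z. - fs \<nu> z)"


section \<open>The Attouch--Wets distance\<close>

definition epi :: "'a set \<Rightarrow> ('a \<Rightarrow> ereal) \<Rightarrow> ('a \<times> real) set" where
  "epi X f = {(x, \<tau>). x \<in> X \<and> f x \<le> ereal \<tau>}"

text \<open>
  The distance of the product type is the Euclidean one. Epigraphs of members of \<open>fcns X\<close> are
  nonempty, so the convention \<open>infdist z {} = 0\<close> plays no role. The supremum is over a nonempty
  compact set when \<open>X\<close> is closed and \<open>zctr \<in> X \<times> UNIV\<close>, hence it is a maximum.
\<close>

definition AW_dist :: "'a::euclidean_space \<times> real \<Rightarrow> 'a set \<Rightarrow> ('a \<Rightarrow> ereal) \<Rightarrow> ('a \<Rightarrow> ereal) \<Rightarrow> real" where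
  "AW_dist zctr X f g =
     (LINT \<rho>:{0<..}|lborel.
        (SUP z\<in>{z \<in> X \<times> UNIV. dist z zctr \<le> \<rho>}. \<bar>infdist z (epi X f) - infdist z (epi X g)\<bar>) * exp (- \<rho>))"

lemma AW_dist_aux:
  fixes c :: "'c::metric_space" and S A B :: "'c set"
  defines "h \<equiv> \<lambda>A B \<rho>. SUP z\<in>{z \<in> S. dist z c \<le> \<rho>}. \<bar>infdist z A - infdist z B\<bar>"
  assumes c: "c \<in> S"
  shows AW_sup_bdd: "bdd_above ((\<lambda>z. \<bar>infdist z A - infdist z B\<bar>) ` {z \<in> S. dist z c \<le> \<rho>})"
    and AW_sup_nonneg: "0 \<le> \<rho> \<Longrightarrow> 0 \<le> h A B \<rho>"
    and AW_sup_mono: "0 \<le> \<rho> \<Longrightarrow> \<rho> \<le> \<rho>' \<Longrightarrow> h A B \<rho> \<le> h A B \<rho>'"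
    and AW_set_integrable: "set_integrable lborel {0<..} (\<lambda>\<rho>. h A B \<rho> * exp (- \<rho>))"
proof -
  have bound: "\<bar>infdist z A - infdist z B\<bar> \<le> 2 * \<rho> + \<bar>infdist c A - infdist c B\<bar>"
    if "dist z c \<le> \<rho>" for z \<rho>
    using infdist_triangle_abs[of z A c] infdist_triangle_abs[of z B c] that by linarith
  then show bdd: "bdd_above ((\<lambda>z. \<bar>infdist z A - infdist z B\<bar>) ` {z \<in> S. dist z c \<le> \<rho>})" for \<rho>
    by (intro bdd_aboveI2) auto
  have cin: "c \<in> {z \<in> S. dist z c \<le> \<rho>}" if "0 \<le> \<rho>" for \<rho>
    using c that by simp
  show nonneg: "0 \<le> h A B \<rho>" if "0 \<le> \<rho>" for \<rho>
    unfolding h_def by (rule cSUP_upper2[OF bdd cin[OF that]]) simp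
  show mono: "h A B \<rho> \<le> h A B \<rho>'" if "0 \<le> \<rho>" "\<rho> \<le> \<rho>'" for \<rho> \<rho>'
    unfolding h_def by (rule cSUP_subset_mono) (use cin[OF that(1)] bdd that in auto)
  have le: "h A B \<rho> \<le> 2 * \<rho> + \<bar>infdist c A - infdist c B\<bar>" if "0 \<le> \<rho>" for \<rho>
    unfolding h_def by (rule cSUP_least) (use cin[OF that] bound in auto)
  have int: "set_integrable lborel {0<..} (\<lambda>x::real. x ^ k * exp (- x))" for k
  proof -
    have "(\<integral>\<^sup>+x. ennreal (x ^ k * exp (- x) * indicator {0..} x) \<partial>lborel) = ennreal (fact k)"
      using nn_intergal_power_times_exp_Ici[of k]
      by (subst nn_integral_cong[where v="\<lambda>x. ennreal (x ^ k * exp (- x)) * indicator {0..} x"])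
         (auto split: split_indicator)
    then have "integrable lborel (\<lambda>x::real. x ^ k * exp (- x) * indicator {0..} x)"
      by (intro integrableI_nn_integral_finite[where x="fact k"]) (auto simp: indicator_def)
    then have "set_integrable lborel {0..} (\<lambda>x::real. x ^ k * exp (- x))"
      by (simp add: set_integrable_def mult.commute)
    then show ?thesis by (rule set_integrable_subset) auto
  qed
  have "set_integrable lborel {0<..} (\<lambda>x::real. 2 * (x ^ 1 * exp (- x)) +
      \<bar>infdist c A - infdist c B\<bar> * (x ^ 0 * exp (- x)))"
    by (intro set_integral_add set_integrable_mult_right int)
  moreover have "mono_on {0<..} (h A B)"
    by (intro mono_onI mono) auto
  then have "h A B \<in> borel_measurable (restrict_space borel {0<..})"
    by (rule borel_measurable_mono_on_fnc)
  then have "(\<lambda>x. indicator {0<..} x *\<^sub>R h A B x) \<in> borel_measurable borel"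
    by (subst (asm) borel_measurable_restrict_space_iff) auto
  then have "(\<lambda>x. (indicator {0<..} x *\<^sub>R h A B x) * exp (- x)) \<in> borel_measurable borel"
    by measurable
  then have "set_borel_measurable lborel {0<..} (\<lambda>\<rho>. h A B \<rho> * exp (- \<rho>))"
    by (simp add: set_borel_measurable_def mult.assoc)
  ultimately show "set_integrable lborel {0<..} (\<lambda>\<rho>. h A B \<rho> * exp (- \<rho>))"
  proof (rule set_integrable_bound)
    show "AE x in lborel. x \<in> {0<..} \<longrightarrow> norm (h A B x * exp (- x)) \<le>
      norm (2 * (x ^ 1 * exp (- x)) + \<bar>infdist c A - infdist c B\<bar> * (x ^ 0 * exp (- x)))"
    proof (intro AE_I2 impI)
      fix x :: real assume "x \<in> {0<..}"
      then have x: "0 \<le> x" by simp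
      have "norm (h A B x * exp (- x)) = h A B x * exp (- x)" using nonneg[OF x] by simp
      also have "\<dots> \<le> (2 * x + \<bar>infdist c A - infdist c B\<bar>) * exp (- x)"
        using le[OF x] by (intro mult_right_mono) auto
      also have "\<dots> = 2 * (x ^ 1 * exp (- x)) + \<bar>infdist c A - infdist c B\<bar> * (x ^ 0 * exp (- x))"
        by (simp add: algebra_simps)
      finally show "norm (h A B x * exp (- x)) \<le>
        norm (2 * (x ^ 1 * exp (- x)) + \<bar>infdist c A - infdist c B\<bar> * (x ^ 0 * exp (- x)))" by simp
    qed
  qed
qed

lemma closed_epi:
  fixes X :: "'a::metric_space set"
  assumes X: "closed X" and f: "lsc_on X f"
  shows "closed (epi X f)"
  unfolding closed_sequential_limits
proof (intro allI impI)
  fix s l assume *: "(\<forall>n. s n \<in> epi X f) \<and> s \<longlonglongrightarrow> l"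
  obtain x t where l: "l = (x, t)" by (cases l)
  have sx: "fst (s n) \<in> X" and st: "f (fst (s n)) \<le> ereal (snd (s n))" for n
    using * by (auto simp: epi_def split_beta)
  have lx: "(\<lambda>n. fst (s n)) \<longlonglongrightarrow> x" and lt: "(\<lambda>n. snd (s n)) \<longlonglongrightarrow> t"
    using * tendsto_fst tendsto_snd unfolding l by fastforce+
  have xX: "x \<in> X" using closed_sequentially[OF X _ lx] sx by auto
  have "f x \<le> ereal t"
  proof (rule ccontr)
    assume "\<not> f x \<le> ereal t"
    then obtain y where y: "ereal t < y" "y < f x"
      using dense[of "ereal t" "f x"] by (auto simp: not_le)
    have "\<forall>\<^sub>F z in at x within X. y < f z"
      using f xX y(2) unfolding lsc_on_def le_Liminf_iff by blast
    then have "\<forall>\<^sub>F z in nhds x. z \<in> X \<longrightarrow> y < f z"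
      unfolding eventually_at_filter by eventually_elim (use y in auto)
    then have "\<forall>\<^sub>F n in sequentially. y < f (fst (s n))"
      using eventually_compose_filterlim[OF _ lx] sx by fastforce
    then have "\<forall>\<^sub>F n in sequentially. y \<le> ereal (snd (s n))"
      using st by (auto elim!: eventually_mono intro: order.trans less_imp_le)
    moreover have "(\<lambda>n. ereal (snd (s n))) \<longlonglongrightarrow> ereal t" using lt by simp
    ultimately have "y \<le> ereal t" by (intro tendsto_lowerbound) auto
    with y show False by simp
  qed
  with xX show "l \<in> epi X f" by (simp add: l epi_def)
qed

lemma epi_inject:
  assumes "f \<in> extensional X" "g \<in> extensional X" "epi X f = epi X g"
  shows "f = g"
proof (rule extensionalityI[OF assms(1,2)])
  fix x assume "x \<in> X"
  then have "f x \<le> ereal t \<longleftrightarrow> g x \<le> ereal t" for t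
    using assms(3) by (auto simp: epi_def set_eq_iff)
  then show "f x = g x"
    by (metis antisym ereal_le_real)
qed

lemma Metric_space_AW_dist:
  fixes X :: "'a::euclidean_space set"
  assumes X: "closed X" and zctr: "zctr \<in> X \<times> UNIV"
  shows "Metric_space (lsc_fcns X) (AW_dist zctr X)"
proof
  define h where "h f g \<rho> =
    (SUP z\<in>{z \<in> X \<times> UNIV. dist z zctr \<le> \<rho>}. \<bar>infdist z (epi X f) - infdist z (epi X g)\<bar>)" for f g \<rho>
  note bdd = AW_sup_bdd[OF zctr]
  have nonneg: "0 \<le> h f g \<rho>" if "0 \<le> \<rho>" for f g \<rho>
    unfolding h_def by (rule AW_sup_nonneg[OF zctr that])
  have mono: "h f g \<rho> \<le> h f g \<rho>'" if "0 \<le> \<rho>" "\<rho> \<le> \<rho>'" for f g \<rho> \<rho>'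
    unfolding h_def by (rule AW_sup_mono[OF zctr that])
  have int: "set_integrable lborel {0<..} (\<lambda>\<rho>. h f g \<rho> * exp (- \<rho>))" for f g
    unfolding h_def by (rule AW_set_integrable[OF zctr])
  have d: "AW_dist zctr X f g = (LINT \<rho>:{0<..}|lborel. h f g \<rho> * exp (- \<rho>))" for f g
    by (simp add: AW_dist_def h_def)
  show "0 \<le> AW_dist zctr X f g" for f g
    unfolding d set_lebesgue_integral_def
    by (intro integral_nonneg_AE AE_I2) (auto simp: indicator_def nonneg)
  show "AW_dist zctr X f g = AW_dist zctr X g f" for f g
    by (simp add: AW_dist_def abs_minus_commute)
  have ne: "{z \<in> X \<times> UNIV. dist z zctr \<le> \<rho>} \<noteq> {}" if "0 \<le> \<rho>" for \<rho>
  proof -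
    have "zctr \<in> {z \<in> X \<times> UNIV. dist z zctr \<le> \<rho>}" using zctr that by simp
    then show ?thesis by blast
  qed
  show "AW_dist zctr X f k \<le> AW_dist zctr X f g + AW_dist zctr X g k" for f g k
  proof -
    have "h f k \<rho> \<le> h f g \<rho> + h g k \<rho>" if "0 \<le> \<rho>" for \<rho>
      unfolding h_def[of f k]
    proof (rule cSUP_least[OF ne[OF that]])
      fix z assume z: "z \<in> {z \<in> X \<times> UNIV. dist z zctr \<le> \<rho>}"
      have "\<bar>infdist z (epi X f) - infdist z (epi X g)\<bar> \<le> h f g \<rho>"
        "\<bar>infdist z (epi X g) - infdist z (epi X k)\<bar> \<le> h g k \<rho>"
        unfolding h_def by (rule cSUP_upper[OF z bdd])+
      then show "\<bar>infdist z (epi X f) - infdist z (epi X k)\<bar> \<le> h f g \<rho> + h g k \<rho>" by linarith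
    qed
    then have "h f k \<rho> * exp (- \<rho>) \<le> h f g \<rho> * exp (- \<rho>) + h g k \<rho> * exp (- \<rho>)" if "\<rho> \<in> {0<..}" for \<rho>
      using that by (simp flip: distrib_right)
    then have "AW_dist zctr X f k \<le>
        (LINT \<rho>:{0<..}|lborel. h f g \<rho> * exp (- \<rho>) + h g k \<rho> * exp (- \<rho>))"
      unfolding d by (intro set_integral_mono int set_integral_add) auto
    then show ?thesis
      unfolding d by (subst (asm) set_integral_add(2)) (auto intro: int)
  qed
  show "AW_dist zctr X f g = 0 \<longleftrightarrow> f = g" if f: "f \<in> lsc_fcns X" and g: "g \<in> lsc_fcns X" for f g
  proof
    assume "f = g"
    have "h g g \<rho> = 0" if "0 \<le> \<rho>" for \<rho>
      using ne[OF that] by (simp add: h_def)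
    then show "AW_dist zctr X f g = 0"
      unfolding d set_lebesgue_integral_def \<open>f = g\<close>
      by (intro integral_eq_zero_AE AE_I2) (auto simp: indicator_def)
  next
    assume "AW_dist zctr X f g = 0"
    then have "AE \<rho> in lborel. indicator {0<..} \<rho> *\<^sub>R (h f g \<rho> * exp (- \<rho>)) = 0"
      using int[of f g] unfolding d set_lebesgue_integral_def set_integrable_def
      by (subst (asm) integral_nonneg_eq_0_iff_AE) (auto simp: indicator_def nonneg)
    then have ae: "AE \<rho> in lborel. 0 < \<rho> \<longrightarrow> h f g \<rho> = 0"
      by eventually_elim (auto simp: indicator_def split: if_splits)
    have h0: "h f g \<rho> = 0" if \<rho>: "0 \<le> \<rho>" for \<rho>
    proof (rule ccontr)
      assume "h f g \<rho> \<noteq> 0"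
      then have "0 < h f g \<rho>" using nonneg[OF \<rho>, of f g] by simp
      then have "h f g r \<noteq> 0" if "\<rho> < r" for r
        using mono[OF \<rho>, of r f g] that by force
      then have "AE r in lborel. r \<notin> {\<rho><..<\<rho> + 1}"
        using ae \<rho> by (auto elim!: eventually_mono)
      then have "emeasure lborel {\<rho><..<\<rho> + 1} = 0"
        by (subst (asm) AE_iff_measurable[of "{\<rho><..<\<rho> + 1}"]) auto
      then show False by simp
    qed
    have eq: "infdist z (epi X f) = infdist z (epi X g)" if "z \<in> X \<times> UNIV" for z
    proof -
      have "\<bar>infdist z (epi X f) - infdist z (epi X g)\<bar> \<le> h f g (dist z zctr)"
        unfolding h_def by (rule cSUP_upper[OF _ bdd]) (use that in auto)
      then show ?thesis by (simp add: h0)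
    qed
    have epi_ne: "epi X k \<noteq> {}" if k: "k \<in> lsc_fcns X" for k
    proof -
      obtain x where x: "x \<in> X" "k x \<noteq> \<infinity>" using k by (auto simp: lsc_fcns_def fcns_def)
      then obtain t where "k x \<le> ereal t" by (cases "k x") auto
      with x show ?thesis by (auto simp: epi_def)
    qed
    have mem: "z \<in> epi X k \<longleftrightarrow> z \<in> X \<times> UNIV \<and> infdist z (epi X k) = 0" if "k \<in> lsc_fcns X" for z k
      using in_closed_iff_infdist_zero[OF closed_epi[OF X] epi_ne[OF that], of z] that
      by (auto simp: lsc_fcns_def epi_def)
    have "epi X f = epi X g"
      using eq mem[OF f] mem[OF g] by (auto simp: set_eq_iff)
    then show "f = g"
      using f g by (intro epi_inject) (auto simp: lsc_fcns_def fcns_def)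
  qed
qed

abbreviation AW_topology ::
    "'a::euclidean_space \<times> real \<Rightarrow> 'a set \<Rightarrow> ('a \<Rightarrow> ereal) set \<Rightarrow> ('a \<Rightarrow> ereal) topology" where
  "AW_topology zctr X S \<equiv> Metric_space.mtopology S (AW_dist zctr X)"

definition LimOut :: "'b topology \<Rightarrow> (nat \<Rightarrow> 'b set) \<Rightarrow> 'b set" where
  "LimOut T S = {z. \<exists>r zs. strict_mono r \<and> (\<forall>\<kappa>. zs \<kappa> \<in> S (r \<kappa>)) \<and> limitin T zs z sequentially}"

definition cluster_point :: "'b topology \<Rightarrow> (nat \<Rightarrow> 'b) \<Rightarrow> 'b \<Rightarrow> bool" where
  "cluster_point T zs z \<longleftrightarrow> (\<exists>r. strict_mono r \<and> limitin T (zs \<circ> r) z sequentially)"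


section \<open>Distributions and expectations\<close>

definition borel_distribution :: "'b::topological_space set \<Rightarrow> 'b measure \<Rightarrow> bool" where
  "borel_distribution \<Xi> P \<longleftrightarrow> prob_space P \<and> sets P = sets (restrict_space borel \<Xi>)"

definition weak_conv_on ::
    "'b::topological_space set \<Rightarrow> (nat \<Rightarrow> 'b measure) \<Rightarrow> 'b measure \<Rightarrow> bool" where
  "weak_conv_on \<Xi> Ps P \<longleftrightarrow>
     (\<forall>h::'b \<Rightarrow> real. continuous_on \<Xi> h \<and> bounded (h ` \<Xi>) \<longrightarrow>
        (\<lambda>\<nu>. \<integral>\<xi>. h \<xi> \<partial>Ps \<nu>) \<longlonglongrightarrow> (\<integral>\<xi>. h \<xi> \<partial>P))"

text \<open>Integration of functions with values in \<open>[-\<infinity>, \<infinity>]\<close>; \<open>e2ennreal\<close> maps negative values to 0.\<close>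

definition ext_integrable :: "'b measure \<Rightarrow> ('b \<Rightarrow> ereal) \<Rightarrow> bool" where
  "ext_integrable M h \<longleftrightarrow> h \<in> borel_measurable M \<and> (\<integral>\<^sup>+\<xi>. e2ennreal \<bar>h \<xi>\<bar> \<partial>M) < \<infinity>"

definition ext_expectation :: "'b measure \<Rightarrow> ('b \<Rightarrow> ereal) \<Rightarrow> ereal" where
  "ext_expectation M h =
     enn2ereal (\<integral>\<^sup>+\<xi>. e2ennreal (h \<xi>) \<partial>M) - enn2ereal (\<integral>\<^sup>+\<xi>. e2ennreal (- h \<xi>) \<partial>M)"


section \<open>Bellman operators\<close>

definition bellman_b ::
    "('a \<Rightarrow> 'b \<Rightarrow> 'a set) \<Rightarrow> real \<Rightarrow> ('a \<times> 'a \<times> 'b \<Rightarrow> real) \<Rightarrow> ('a \<Rightarrow> ereal) \<Rightarrow> 'a \<times> 'b \<Rightarrow> ereal" where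
  "bellman_b Y \<beta> \<phi> f = (\<lambda>(x, \<xi>). INF y\<in>Y x \<xi>. ereal (\<phi> (x, y, \<xi>)) + ereal \<beta> * f y)"

definition bellman_B ::
    "'a set \<Rightarrow> ('a \<Rightarrow> 'b \<Rightarrow> 'a set) \<Rightarrow> real \<Rightarrow> ('a \<times> 'a \<times> 'b \<Rightarrow> real) \<Rightarrow> 'b measure \<Rightarrow>
      ('a \<Rightarrow> ereal) \<Rightarrow> 'a \<Rightarrow> ereal" where
  "bellman_B X Y \<beta> \<phi> P f = (\<lambda>x\<in>X. ext_expectation P (\<lambda>\<xi>. bellman_b Y \<beta> \<phi> f (x, \<xi>)))"

definition bellman_regular ::
    "'a set \<Rightarrow> ('a \<Rightarrow> 'b \<Rightarrow> 'a set) \<Rightarrow> real \<Rightarrow> ('a \<times> 'a \<times> 'b \<Rightarrow> real) \<Rightarrow> 'b measure \<Rightarrow>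
      ('a \<Rightarrow> ereal) set \<Rightarrow> bool" where
  "bellman_regular X Y \<beta> \<phi> P \<V> \<longleftrightarrow>
     (\<forall>V\<in>\<V>. (\<forall>x\<in>X. ext_integrable P (\<lambda>\<xi>. bellman_b Y \<beta> \<phi> V (x, \<xi>))) \<and> bellman_B X Y \<beta> \<phi> P V \<in> \<V>)"

definition bellman_fixed ::
    "'a::euclidean_space \<times> real \<Rightarrow> 'a set \<Rightarrow> (('a \<Rightarrow> ereal) \<Rightarrow> ('a \<Rightarrow> ereal)) \<Rightarrow>
      ('a \<Rightarrow> ereal) set \<Rightarrow> ('a \<Rightarrow> ereal) set" where
  "bellman_fixed zctr X B \<V> = {V \<in> \<V>. AW_dist zctr X V (B V) = 0}"

end

theory Submission
  imports Defs
begin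

text \<open>
  Let \<open>W\<close> be a limit of fixed points \<open>V\<^sub>k = B\<^sub>\<nu>(V\<^sub>k)\<close> taken along a subsequence \<open>\<nu> = r k\<close>. The
  equation \<open>W = B W\<close> is a pointwise one, so it is enough to pass to the limit at each \<open>x\<close> on both sides
  of \<open>V\<^sub>k(x) = B\<^sub>\<nu>(V\<^sub>k)(x)\<close>. The hypotheses speak of full sequences; filling the indices outside the
  subsequence with \<open>W\<close> itself yields a full sequence in \<open>\<V>\<close> that still converges to \<open>W\<close>.

  The left-hand sides converge because Attouch--Wets convergence implies epi-convergence
  (\<open>AW_conv_imp_epi_conv\<close>) and epi-convergent equi-lsc sequences converge pointwise
  (\<open>epi_conv_equi_lsc_tendsto\<close>).

  For the right-hand sides write \<open>g\<^sub>\<nu>(\<xi>) = b\<^sub>\<nu>(V\<^sub>\<nu>)(x, \<xi>)\<close> and \<open>g(\<xi>) = b(W)(x, \<xi>)\<close>. Compactness of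
  \<open>Y x \<xi>\<close> turns the epi- and pointwise convergence of the objectives into convergence of their
  minimal values, \<open>g\<^sub>\<nu>(\<xi>) \<rightarrow> g(\<xi>)\<close> (\<open>bellman_b_tendsto\<close>). Equi-lower and equi-upper semicontinuity in
  \<open>\<xi>\<close> upgrade this to convergence jointly in the index and the argument
  (\<open>equi_semicont_cont_conv\<close>). Such convergence is locally uniform, so after clamping the values to
  \<open>[-c, c]\<close> the expectations converge: a weakly convergent sequence of distributions is tight, hence
  only a compact set matters (\<open>weak_conv_on_cont_conv_integral\<close>). The tail conditions make the error of
  the clamping small uniformly in large \<open>\<nu>\<close>, and integrability of \<open>g\<close> makes it small in the limit,
  which gives \<open>E\<^sub>\<nu>[g\<^sub>\<nu>] \<rightarrow> E[g]\<close> (\<open>ext_expectation_tendsto\<close>).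

  The statements about cluster points follow: a cluster point of fixed points lies in the outer limit,
  as \<open>\<V>\<close> is closed, and compactness supplies a cluster point.
\<close>

section \<open>Continuous convergence and equi-semicontinuity\<close>

abbreviation (input) jointly_at :: "'a::topological_space set \<Rightarrow> 'a \<Rightarrow> (nat \<times> 'a) filter" where
  "jointly_at Z z0 \<equiv> sequentially \<times>\<^sub>F inf (nhds z0) (principal Z)"

text \<open>
  Continuous convergence, stated as a limit along a product filter. For metric spaces this is
  \<open>gs \<nu> (z \<nu>) \<rightarrow> g z\<close> for all sequences \<open>z \<nu> \<rightarrow> z\<close> in \<open>Z\<close>; the filter form spares the extraction of
  subsequences and composes directly with continuous maps such as a clamping.
\<close>

definition cont_conv ::
    "'a::topological_space set \<Rightarrow> (nat \<Rightarrow> 'a \<Rightarrow> 'b::topological_space) \<Rightarrow> ('a \<Rightarrow> 'b) \<Rightarrow> bool" where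
  "cont_conv Z gs g \<longleftrightarrow> (\<forall>z0\<in>Z. ((\<lambda>(\<nu>, z). gs \<nu> z) \<longlongrightarrow> g z0) (jointly_at Z z0))"

lemma eventually_inf_nhds_principal_metric:
  fixes z0 :: "'a::metric_space"
  shows "eventually P (inf (nhds z0) (principal Z)) \<longleftrightarrow>
    (\<exists>\<delta>>0. \<forall>z\<in>Z. dist z z0 < \<delta> \<longrightarrow> P z)"
  unfolding eventually_inf_principal eventually_nhds_metric by blast

lemma eventually_jointly_at:
  fixes z0 :: "'a::metric_space"
  shows "eventually P (jointly_at Z z0) \<longleftrightarrow>
    (\<exists>N. \<exists>\<delta>>0. \<forall>\<nu>\<ge>N. \<forall>z\<in>Z. dist z z0 < \<delta> \<longrightarrow> P (\<nu>, z))"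
proof
  assume "eventually P (jointly_at Z z0)"
  then obtain Q R where "eventually Q sequentially" "eventually R (inf (nhds z0) (principal Z))"
    and QR: "\<And>\<nu> z. Q \<nu> \<Longrightarrow> R z \<Longrightarrow> P (\<nu>, z)"
    unfolding eventually_prod_filter by blast
  then obtain N \<delta> where "\<forall>\<nu>\<ge>N. Q \<nu>" "0 < \<delta>" "\<forall>z\<in>Z. dist z z0 < \<delta> \<longrightarrow> R z"
    unfolding eventually_sequentially eventually_inf_nhds_principal_metric by blast
  with QR show "\<exists>N. \<exists>\<delta>>0. \<forall>\<nu>\<ge>N. \<forall>z\<in>Z. dist z z0 < \<delta> \<longrightarrow> P (\<nu>, z)"
    by (intro exI[of _ N] exI[of _ \<delta>]) simp
next
  assume "\<exists>N. \<exists>\<delta>>0. \<forall>\<nu>\<ge>N. \<forall>z\<in>Z. dist z z0 < \<delta> \<longrightarrow> P (\<nu>, z)"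
  then obtain N \<delta> where \<delta>: "0 < \<delta>" and P: "\<forall>\<nu>\<ge>N. \<forall>z\<in>Z. dist z z0 < \<delta> \<longrightarrow> P (\<nu>, z)"
    by blast
  have "eventually (\<lambda>z. z \<in> Z \<and> dist z z0 < \<delta>) (inf (nhds z0) (principal Z))"
    unfolding eventually_inf_nhds_principal_metric using \<delta> by blast
  with eventually_ge_at_top[of N] show "eventually P (jointly_at Z z0)"
    unfolding eventually_prod_filter using P by blast
qed

text \<open>
  The centre itself belongs to every neighbourhood relative to \<open>Z\<close>. This specialises joint limits in
  \<open>(\<nu>, x)\<close>, and in particular the lower tail condition, to the single argument \<open>x\<close>.
\<close>

lemma eventually_jointly_at_center:
  assumes "eventually P (jointly_at Z z0)" "z0 \<in> Z"
  shows "\<forall>\<^sub>F \<nu> in sequentially. P (\<nu>, z0)"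
proof -
  obtain Q R where Q: "eventually Q sequentially"
    and R: "eventually R (inf (nhds z0) (principal Z))" and QR: "\<And>\<nu> z. Q \<nu> \<Longrightarrow> R z \<Longrightarrow> P (\<nu>, z)"
    using assms(1) unfolding eventually_prod_filter by blast
  have "R z0" using R assms(2) unfolding eventually_inf_principal
    by (auto dest: eventually_nhds_x_imp_x)
  with Q QR show ?thesis by (auto elim: eventually_mono)
qed

lemma cont_conv_imp_tendsto:
  assumes "cont_conv Z gs g" "z \<in> Z"
  shows "(\<lambda>\<nu>. gs \<nu> z) \<longlonglongrightarrow> g z"
proof (rule topological_tendstoI)
  fix S assume "open S" "g z \<in> S"
  with assms have "\<forall>\<^sub>F p in jointly_at Z z. (case p of (\<nu>, z) \<Rightarrow> gs \<nu> z) \<in> S"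
    unfolding cont_conv_def by (intro topological_tendstoD[of _ "g z"]) auto
  from eventually_jointly_at_center[OF this assms(2)] show "\<forall>\<^sub>F \<nu> in sequentially. gs \<nu> z \<in> S"
    by simp
qed

lemma cont_conv_eventually_close:
  fixes gs :: "nat \<Rightarrow> 'a::metric_space \<Rightarrow> real"
  assumes cc: "cont_conv Z gs g" and z0: "z0 \<in> Z" and e: "0 < e"
  shows "\<exists>N. \<exists>\<delta>>0. (\<forall>\<nu>\<ge>N. \<forall>z\<in>Z. dist z z0 < \<delta> \<longrightarrow> \<bar>gs \<nu> z - g z0\<bar> < e) \<and>
    (\<forall>z\<in>Z. dist z z0 < \<delta> \<longrightarrow> \<bar>g z - g z0\<bar> \<le> e)"
proof -
  have "\<forall>\<^sub>F p in jointly_at Z z0. dist (case p of (\<nu>, z) \<Rightarrow> gs \<nu> z) (g z0) < e"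
    using cc z0 e unfolding cont_conv_def by (intro tendstoD[of _ "g z0"]) auto
  then obtain N \<delta> where \<delta>: "0 < \<delta>"
    and *: "\<And>\<nu> z. N \<le> \<nu> \<Longrightarrow> z \<in> Z \<Longrightarrow> dist z z0 < \<delta> \<Longrightarrow> \<bar>gs \<nu> z - g z0\<bar> < e"
    unfolding eventually_jointly_at dist_real_def by auto
  have "\<bar>g z - g z0\<bar> \<le> e" if z: "z \<in> Z" "dist z z0 < \<delta>" for z
  proof (rule tendsto_upperbound)
    show "(\<lambda>\<nu>. \<bar>gs \<nu> z - g z0\<bar>) \<longlonglongrightarrow> \<bar>g z - g z0\<bar>"
      by (intro tendsto_intros cont_conv_imp_tendsto[OF cc] z)
    show "\<forall>\<^sub>F \<nu> in sequentially. \<bar>gs \<nu> z - g z0\<bar> \<le> e"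
      using *[OF _ z] by (auto simp: eventually_sequentially intro!: exI[of _ N] less_imp_le)
  qed simp
  with \<delta> * show ?thesis by blast
qed

text \<open>
  Near \<open>z0\<close>, all late \<open>gs \<nu>\<close> stay close to the single number \<open>g z0\<close>; letting \<open>\<nu>\<close> tend to infinity at a
  fixed nearby \<open>z\<close> transfers this to \<open>g z\<close>.
\<close>

lemma cont_conv_continuous_limit:
  fixes gs :: "nat \<Rightarrow> 'a::metric_space \<Rightarrow> real"
  assumes "cont_conv Z gs g"
  shows "continuous_on Z g"
  unfolding continuous_on_iff
proof (intro ballI allI impI)
  fix z0 e assume z0: "z0 \<in> Z" and e: "0 < (e::real)"
  obtain N \<delta> where "0 < \<delta>" "\<And>z. z \<in> Z \<Longrightarrow> dist z z0 < \<delta> \<Longrightarrow> \<bar>g z - g z0\<bar> \<le> e / 2"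
    using cont_conv_eventually_close[OF assms z0 half_gt_zero[OF e]] by blast
  with e show "\<exists>d>0. \<forall>z\<in>Z. dist z z0 < d \<longrightarrow> dist (g z) (g z0) < e"
    by (intro exI[of _ \<delta>]) (fastforce simp: dist_real_def)
qed

text \<open>
  Both \<open>gs \<nu> z\<close> and \<open>g z\<close> are close to \<open>g z0\<close> on a ball around each \<open>z0\<close>, with one threshold for \<open>\<nu>\<close>
  per ball. Finitely many balls cover a compact set.
\<close>

lemma cont_conv_uniform_on_compact:
  fixes gs :: "nat \<Rightarrow> 'a::metric_space \<Rightarrow> real"
  assumes cc: "cont_conv Z gs g" and K: "compact K" "K \<subseteq> Z" and e: "0 < e"
  shows "\<forall>\<^sub>F \<nu> in sequentially. \<forall>z\<in>K. \<bar>gs \<nu> z - g z\<bar> < e"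
proof -
  have "\<exists>N \<delta>. 0 < \<delta> \<and> (\<forall>\<nu>\<ge>N. \<forall>z\<in>Z. dist z z0 < \<delta> \<longrightarrow> \<bar>gs \<nu> z - g z\<bar> < e)" if z0: "z0 \<in> Z" for z0
  proof -
    obtain N \<delta> where \<delta>: "0 < \<delta>"
      and *: "\<And>\<nu> z. N \<le> \<nu> \<Longrightarrow> z \<in> Z \<Longrightarrow> dist z z0 < \<delta> \<Longrightarrow> \<bar>gs \<nu> z - g z0\<bar> < e / 2"
      and **: "\<And>z. z \<in> Z \<Longrightarrow> dist z z0 < \<delta> \<Longrightarrow> \<bar>g z - g z0\<bar> \<le> e / 2"
      using cont_conv_eventually_close[OF cc z0 half_gt_zero[OF e]] by blast
    have "\<bar>gs \<nu> z - g z\<bar> < e" if "N \<le> \<nu>" "z \<in> Z" "dist z z0 < \<delta>" for \<nu> z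
      using *[OF that] **[OF that(2,3)] by linarith
    with \<delta> show ?thesis by blast
  qed
  then obtain N \<delta> where \<delta>: "\<And>z0. z0 \<in> Z \<Longrightarrow> 0 < \<delta> z0"
    and *: "\<And>z0 \<nu> z. z0 \<in> Z \<Longrightarrow> N z0 \<le> \<nu> \<Longrightarrow> z \<in> Z \<Longrightarrow> dist z z0 < \<delta> z0 \<Longrightarrow> \<bar>gs \<nu> z - g z\<bar> < e"
    by metis
  have "K \<subseteq> (\<Union>c\<in>K. ball c (\<delta> c))" using \<delta> K(2) by force
  then obtain C where C: "C \<subseteq> K" "finite C" "K \<subseteq> (\<Union>c\<in>C. ball c (\<delta> c))"
    using compactE_image[OF K(1), of K "\<lambda>c. ball c (\<delta> c)"] by auto
  have "\<forall>\<^sub>F \<nu> in sequentially. \<forall>c\<in>C. N c \<le> \<nu>"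
    by (intro eventually_ball_finite C ballI eventually_ge_at_top)
  then show ?thesis
  proof eventually_elim
    case (elim \<nu>)
    show ?case
    proof
      fix z assume z: "z \<in> K"
      then obtain c where "c \<in> C" "dist c z < \<delta> c" using C(3) by auto
      then show "\<bar>gs \<nu> z - g z\<bar> < e"
        using *[of c \<nu> z] elim z C(1) K(2) by (auto simp: dist_commute)
    qed
  qed
qed

text \<open>
  Equi-lower semicontinuity makes a pointwise limit survive a simultaneous variation
  of the argument, on the lower side.
\<close>

lemma equi_lsc_Liminf_ge:
  assumes lsc: "equi_lsc Z gs" and z0: "z0 \<in> Z" and lim: "(\<lambda>\<nu>. gs \<nu> z0) \<longlonglongrightarrow> l"
  shows "l \<le> Liminf (jointly_at Z z0) (\<lambda>(\<nu>, z). gs \<nu> z)"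
  unfolding le_Liminf_iff
proof (intro allI impI)
  fix y assume y: "y < l"
  then obtain c where c: "y < ereal c" "ereal c < l" using ereal_dense2 by blast
  then obtain d where d: "ereal c < ereal d" "ereal d < l" using ereal_dense2 by blast
  \<comment> \<open>Slack \<open>d - c\<close> and cap \<open>max 1 c\<close> turn \<open>gs \<nu> z0 > d\<close> into the bound \<open>c\<close> near \<open>z0\<close>; the 1 keeps the
      cap positive.\<close>
  have "\<not> (\<lambda>\<nu>. gs \<nu> z0) \<longlonglongrightarrow> - \<infinity>" using LIMSEQ_unique[OF lim] y by auto
  moreover have "0 < max 1 c" "0 < d - c" using d by auto
  ultimately obtain N \<delta> where \<delta>: "0 < \<delta>" and
    *: "\<And>\<nu>. N \<le> \<nu> \<Longrightarrow> (INF z\<in>{z\<in>Z. dist z z0 \<le> \<delta>}. gs \<nu> z) \<ge>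
          min (gs \<nu> z0 - ereal (d - c)) (ereal (max 1 c))"
    using lsc z0 unfolding equi_lsc_def by blast
  obtain N' where N': "\<And>\<nu>. N' \<le> \<nu> \<Longrightarrow> ereal d < gs \<nu> z0"
    using order_tendstoD(1)[OF lim d(2)] unfolding eventually_sequentially by blast
  have "y < gs \<nu> z" if "max N N' \<le> \<nu>" "z \<in> Z" "dist z z0 < \<delta>" for \<nu> z
  proof -
    have "ereal c \<le> gs \<nu> z0 - ereal (d - c)"
      using N'[of \<nu>] that(1) by (cases "gs \<nu> z0") auto
    moreover have "ereal c \<le> ereal (max 1 c)" by simp
    ultimately have "ereal c \<le> min (gs \<nu> z0 - ereal (d - c)) (ereal (max 1 c))" by simp
    also have "\<dots> \<le> (INF z\<in>{z\<in>Z. dist z z0 \<le> \<delta>}. gs \<nu> z)" using *[of \<nu>] that(1) by simp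
    also have "\<dots> \<le> gs \<nu> z" using that by (intro INF_lower) auto
    finally show ?thesis using c(1) by order
  qed
  with \<delta> show "\<forall>\<^sub>F p in jointly_at Z z0. y < (case p of (\<nu>, z) \<Rightarrow> gs \<nu> z)"
    unfolding eventually_jointly_at by fastforce
qed

text \<open>
  The lower bound applied to \<open>gs\<close> and to \<open>- gs\<close> squeezes the joint limit.
\<close>

lemma equi_semicont_cont_conv:
  assumes lsc: "equi_lsc Z gs" and usc: "equi_usc Z gs"
    and lim: "\<And>z. z \<in> Z \<Longrightarrow> (\<lambda>\<nu>. gs \<nu> z) \<longlonglongrightarrow> g z"
  shows "cont_conv Z gs g"
  unfolding cont_conv_def
proof
  fix z0 assume z0: "z0 \<in> Z"
  have "- g z0 \<le> Liminf (jointly_at Z z0) (\<lambda>(\<nu>, z). - gs \<nu> z)"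
    by (rule equi_lsc_Liminf_ge[OF usc[unfolded equi_usc_def] z0])
      (rule tendsto_uminus_ereal[OF lim[OF z0]])
  also have "\<dots> = - Limsup (jointly_at Z z0) (\<lambda>(\<nu>, z). gs \<nu> z)"
    unfolding ereal_Liminf_uminus[symmetric] by (simp add: case_prod_unfold)
  finally have up: "Limsup (jointly_at Z z0) (\<lambda>(\<nu>, z). gs \<nu> z) \<le> g z0" by simp
  have ne: "jointly_at Z z0 \<noteq> bot"
    using eventually_jointly_at_center[OF _ z0, of "\<lambda>_. False"] unfolding trivial_limit_def by auto
  have lo: "g z0 \<le> Liminf (jointly_at Z z0) (\<lambda>(\<nu>, z). gs \<nu> z)"
    by (rule equi_lsc_Liminf_ge[OF lsc z0 lim[OF z0]])
  show "((\<lambda>(\<nu>, z). gs \<nu> z) \<longlongrightarrow> g z0) (jointly_at Z z0)"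
    using lo up Liminf_le_Limsup[OF ne, of "\<lambda>(\<nu>, z). gs \<nu> z"]
    by (intro Liminf_eq_Limsup ne antisym) auto
qed

lemma equi_lsc_section:
  assumes lsc: "equi_lsc (A \<times> C) gs" and x: "x \<in> A"
  shows "equi_lsc C (\<lambda>\<nu> \<xi>. gs \<nu> (x, \<xi>))"
  unfolding equi_lsc_def
proof
  fix \<xi>0 assume \<xi>0: "\<xi>0 \<in> C"
  have sub: "(INF z\<in>{z\<in>A \<times> C. dist z (x, \<xi>0) \<le> \<delta>}. gs \<nu> z) \<le> (INF \<xi>\<in>{\<xi>\<in>C. dist \<xi> \<xi>0 \<le> \<delta>}. gs \<nu> (x, \<xi>))"
    for \<nu> \<delta>
    using x by (auto intro!: INF_greatest INF_lower simp: dist_Pair_Pair)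
  have "(x, \<xi>0) \<in> A \<times> C" using x \<xi>0 by simp
  from bspec[OF lsc[unfolded equi_lsc_def] this]
  show "((\<lambda>\<nu>. gs \<nu> (x, \<xi>0)) \<longlonglongrightarrow> - \<infinity>) \<or>
     (\<forall>\<rho>>0. \<forall>\<epsilon>>0. \<exists>N. \<exists>\<delta>>0. \<forall>\<nu>\<ge>N.
        (INF \<xi>\<in>{\<xi>\<in>C. dist \<xi> \<xi>0 \<le> \<delta>}. gs \<nu> (x, \<xi>)) \<ge> min (gs \<nu> (x, \<xi>0) - ereal \<epsilon>) (ereal \<rho>))"
    (is "?L \<or> ?R")
  proof (elim disjE)
    assume R: "\<forall>\<rho>>0. \<forall>\<epsilon>>0. \<exists>N. \<exists>\<delta>>0. \<forall>\<nu>\<ge>N.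
      (INF z\<in>{z\<in>A \<times> C. dist z (x, \<xi>0) \<le> \<delta>}. gs \<nu> z) \<ge> min (gs \<nu> (x, \<xi>0) - ereal \<epsilon>) (ereal \<rho>)"
    have ?R
    proof (intro allI impI)
      fix \<rho> \<epsilon> :: real assume "0 < \<rho>" "0 < \<epsilon>"
      with R obtain N \<delta> where "0 < \<delta>" and *: "\<And>\<nu>. N \<le> \<nu> \<Longrightarrow>
          min (gs \<nu> (x, \<xi>0) - ereal \<epsilon>) (ereal \<rho>) \<le> (INF z\<in>{z\<in>A \<times> C. dist z (x, \<xi>0) \<le> \<delta>}. gs \<nu> z)"
        by blast
      then show "\<exists>N. \<exists>\<delta>>0. \<forall>\<nu>\<ge>N.
          (INF \<xi>\<in>{\<xi>\<in>C. dist \<xi> \<xi>0 \<le> \<delta>}. gs \<nu> (x, \<xi>)) \<ge> min (gs \<nu> (x, \<xi>0) - ereal \<epsilon>) (ereal \<rho>)"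
        by (intro exI[of _ N] exI[of _ \<delta>] conjI allI impI order_trans[OF * sub])
    qed
    then show ?thesis ..
  qed (rule disjI1)
qed

section \<open>Epi-convergence: pointwise limits and subsequences\<close>

lemma epi_conv_liminf_ge:
  assumes "epi_conv Z fs f" "\<And>\<nu>. zs \<nu> \<in> Z" "zs \<longlonglongrightarrow> z" "z \<in> Z"
  shows "f z \<le> liminf (\<lambda>\<nu>. fs \<nu> (zs \<nu>))"
  using assms unfolding epi_conv_def by blast

text \<open>
  The liminf bound of epi-convergence along the constant sequence gives one half. For the other half,
  the recovery sequence converges to \<open>z\<close>, and equi-lower semicontinuity bounds the values at \<open>z\<close> itself
  by those along the recovery sequence, up to a small error.
\<close>

lemma epi_conv_equi_lsc_tendsto:
  assumes epi: "epi_conv Z fs f" and lsc: "equi_lsc Z fs" and z: "z \<in> Z"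
  shows "(\<lambda>\<nu>. fs \<nu> z) \<longlonglongrightarrow> f z"
proof (cases "(\<lambda>\<nu>. fs \<nu> z) \<longlonglongrightarrow> - \<infinity>")
  case True
  have "f z \<le> liminf (\<lambda>\<nu>. fs \<nu> z)"
    by (rule epi_conv_liminf_ge[OF epi]) (use z in auto)
  then have "f z = - \<infinity>" using lim_imp_Liminf[OF _ True] by simp
  with True show ?thesis by simp
next
  case False
  have lo: "f z \<le> liminf (\<lambda>\<nu>. fs \<nu> z)"
    by (rule epi_conv_liminf_ge[OF epi]) (use z in auto)
  have up: "limsup (\<lambda>\<nu>. fs \<nu> z) \<le> f z"
    unfolding Limsup_le_iff
  proof (intro allI impI)
    fix y assume y: "f z < y"
    then obtain d where d: "f z < ereal d" "ereal d < y" using ereal_dense2 by blast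
    then obtain c where c: "f z < ereal c" "ereal c < ereal d" using ereal_dense2 by blast
    have "0 < max 1 c" "0 < d - c" using c by auto
    with False obtain N \<delta> where \<delta>: "0 < \<delta>" and
      *: "\<And>\<nu>. N \<le> \<nu> \<Longrightarrow> (INF z'\<in>{z'\<in>Z. dist z' z \<le> \<delta>}. fs \<nu> z') \<ge>
            min (fs \<nu> z - ereal (d - c)) (ereal (max 1 c))"
      using lsc z unfolding equi_lsc_def by blast
    obtain zs where zs: "\<And>\<nu>. zs \<nu> \<in> Z" "zs \<longlonglongrightarrow> z" "limsup (\<lambda>\<nu>. fs \<nu> (zs \<nu>)) \<le> f z"
      using epi z unfolding epi_conv_def by blast
    have "\<forall>\<^sub>F \<nu> in sequentially. fs \<nu> (zs \<nu>) < ereal c"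
      by (rule Limsup_lessD) (use zs(3) c(1) in order)
    moreover have "\<forall>\<^sub>F \<nu> in sequentially. dist (zs \<nu>) z < \<delta>" using tendstoD[OF zs(2) \<delta>] .
    ultimately show "\<forall>\<^sub>F \<nu> in sequentially. y > fs \<nu> z" using eventually_ge_at_top[of N]
    proof eventually_elim
      case (elim \<nu>)
      have "min (fs \<nu> z - ereal (d - c)) (ereal (max 1 c)) \<le> fs \<nu> (zs \<nu>)"
        by (rule order_trans[OF *[OF elim(3)] INF_lower]) (use zs(1)[of \<nu>] elim(2) in auto)
      also have "\<dots> < ereal c" by (rule elim(1))
      finally have "fs \<nu> z - ereal (d - c) < ereal c" by (auto simp: min_less_iff_disj)
      then have "fs \<nu> z < ereal d" by (cases "fs \<nu> z") auto
      then show ?case using d(2) by order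
    qed
  qed
  show ?thesis
    using lo up Liminf_le_Limsup[of sequentially "\<lambda>\<nu>. fs \<nu> z"]
    by (intro Liminf_eq_Limsup antisym) auto
qed

text \<open>
  Completes a sequence that is indexed along a subsequence \<open>r\<close> to one indexed by all natural numbers, with
  its prospective limit \<open>z\<close> at the missing indices. Every property that holds eventually along the
  subsequence and at \<open>z\<close> then holds eventually.
\<close>

definition fill :: "(nat \<Rightarrow> nat) \<Rightarrow> (nat \<Rightarrow> 'a) \<Rightarrow> 'a \<Rightarrow> nat \<Rightarrow> 'a" where
  "fill r zs z \<nu> = (if \<nu> \<in> range r then zs (inv r \<nu>) else z)"

lemma fill_at: "strict_mono (r :: nat \<Rightarrow> nat) \<Longrightarrow> fill r zs z (r k) = zs k"
  by (simp add: fill_def inv_f_f strict_mono_imp_inj_on)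

lemma eventually_fill:
  assumes r: "strict_mono r" and ev: "\<forall>\<^sub>F k in sequentially. Q (zs k)" and z: "Q z"
  shows "\<forall>\<^sub>F \<nu> in sequentially. Q (fill r zs z \<nu>)"
proof -
  obtain K where K: "\<And>k. K \<le> k \<Longrightarrow> Q (zs k)" using ev unfolding eventually_sequentially by blast
  have "Q (fill r zs z \<nu>)" if "r K \<le> \<nu>" for \<nu>
  proof (cases "\<nu> \<in> range r")
    case True
    then obtain k where "\<nu> = r k" by blast
    then show ?thesis using K that r by (simp add: fill_at strict_mono_less_eq)
  qed (simp add: fill_def z)
  then show ?thesis unfolding eventually_sequentially by blast
qed

lemma tendsto_fill:
  assumes "strict_mono r" "zs \<longlonglongrightarrow> z"
  shows "fill r zs z \<longlonglongrightarrow> z"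
  using assms by (auto intro!: topological_tendstoI eventually_fill dest: topological_tendstoD)

lemma fill_in: "(\<And>k. zs k \<in> A) \<Longrightarrow> z \<in> A \<Longrightarrow> fill r zs z \<nu> \<in> A"
  by (simp add: fill_def)

text \<open>
  The liminf half of epi-convergence is inherited by subsequences; the missing arguments are filled
  with the limit point.
\<close>

lemma epi_conv_liminf_subseq:
  assumes epi: "epi_conv Z fs f" and r: "strict_mono r"
    and zs: "\<And>k. zs k \<in> Z" "zs \<longlonglongrightarrow> z" and z: "z \<in> Z"
  shows "f z \<le> liminf (\<lambda>k. fs (r k) (zs k))"
proof -
  have "f z \<le> liminf (\<lambda>\<nu>. fs \<nu> (fill r zs z \<nu>))"
    using epi z zs tendsto_fill[OF r zs(2)] unfolding epi_conv_def by (simp add: fill_in)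
  also have "\<dots> \<le> liminf ((\<lambda>\<nu>. fs \<nu> (fill r zs z \<nu>)) \<circ> r)" by (rule liminf_subseq_mono[OF r])
  also have "\<dots> = liminf (\<lambda>k. fs (r k) (zs k))" by (simp add: o_def fill_at[OF r])
  finally show ?thesis .
qed

section \<open>Attouch--Wets convergence implies epi-convergence\<close>

text \<open>
  The Attouch--Wets integrand without its exponential weight is nondecreasing in the radius, so its
  value at radius \<open>\<rho>\<close> is controlled by the integral over \<open>(\<rho>, \<rho> + 1]\<close>. Hence a small distance forces the
  distance functions to the epigraphs to be uniformly close on bounded sets.
\<close>

lemma infdist_diff_le_AW_dist:
  fixes X :: "'a::euclidean_space set"
  assumes zctr: "zctr \<in> X \<times> UNIV" and z: "z \<in> X \<times> UNIV" "dist z zctr \<le> \<rho>"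
  shows "\<bar>infdist z (epi X f) - infdist z (epi X g)\<bar> * exp (- (\<rho> + 1)) \<le> AW_dist zctr X f g"
proof -
  define h where "h \<rho> =
    (SUP z\<in>{z \<in> X \<times> UNIV. dist z zctr \<le> \<rho>}. \<bar>infdist z (epi X f) - infdist z (epi X g)\<bar>)" for \<rho>
  have \<rho>: "0 \<le> \<rho>" using z(2) zero_le_dist[of z zctr] by linarith
  have mono: "h s \<le> h t" if "0 \<le> s" "s \<le> t" for s t
    unfolding h_def by (rule AW_sup_mono[OF zctr that])
  have nonneg: "0 \<le> h s" if "0 \<le> s" for s unfolding h_def by (rule AW_sup_nonneg[OF zctr that])
  have int: "set_integrable lborel {0<..} (\<lambda>s. h s * exp (- s))"
    unfolding h_def by (rule AW_set_integrable[OF zctr])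
  have "\<bar>infdist z (epi X f) - infdist z (epi X g)\<bar> \<le> h \<rho>"
    unfolding h_def by (rule cSUP_upper[OF _ AW_sup_bdd[OF zctr]]) (use z in auto)
  then have "\<bar>infdist z (epi X f) - infdist z (epi X g)\<bar> * exp (- (\<rho> + 1)) \<le> h \<rho> * exp (- (\<rho> + 1))"
    by (rule mult_right_mono) simp
  also have "\<dots> = (\<integral>s. indicator {\<rho><..\<rho> + 1} s *\<^sub>R (h \<rho> * exp (- (\<rho> + 1))) \<partial>lborel)" by simp
  also have "\<dots> \<le> (\<integral>s. indicator {0<..} s *\<^sub>R (h s * exp (- s)) \<partial>lborel)"
  proof (rule integral_mono)
    show "integrable lborel (\<lambda>s. indicator {0<..} s *\<^sub>R (h s * exp (- s)))"
      using int by (simp add: set_integrable_def)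
    fix s :: real
    show "indicator {\<rho><..\<rho> + 1} s *\<^sub>R (h \<rho> * exp (- (\<rho> + 1))) \<le> indicator {0<..} s *\<^sub>R (h s * exp (- s))"
    proof (cases "s \<in> {\<rho><..\<rho> + 1}")
      case True
      then have "h \<rho> * exp (- (\<rho> + 1)) \<le> h s * exp (- s)"
        using \<rho> by (intro mult_mono mono nonneg) auto
      then show ?thesis using True \<rho> by simp
    qed (use nonneg[of s] in \<open>auto simp: indicator_def\<close>)
  qed simp
  also have "\<dots> = AW_dist zctr X f g" by (simp add: AW_dist_def h_def set_lebesgue_integral_def)
  finally show ?thesis .
qed

text \<open>
  A diagonal argument: \<open>\<kappa> \<nu>\<close> is the largest index up to \<open>\<nu>\<close> whose property already holds at \<open>\<nu>\<close>. It serves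
  to approximate a value \<open>-\<infinity>\<close>, at which no single epigraph point suffices.
\<close>

lemma eventually_diagonal:
  assumes ev: "\<And>k::nat. \<forall>\<^sub>F \<nu> in sequentially. Q k \<nu>"
  shows "\<exists>\<kappa>. filterlim \<kappa> at_top sequentially \<and> (\<forall>\<^sub>F \<nu> in sequentially. Q (\<kappa> \<nu>) \<nu>)"
proof -
  define S where "S \<nu> = {k. k \<le> \<nu> \<and> (k = 0 \<or> Q k \<nu>)}" for \<nu>
  have S: "finite (S \<nu>)" "S \<nu> \<noteq> {}" for \<nu>
    by (auto simp: S_def intro: finite_subset[of _ "{..\<nu>}"])
  have "filterlim (\<lambda>\<nu>. Max (S \<nu>)) at_top sequentially"
    unfolding filterlim_at_top
  proof
    fix K
    show "\<forall>\<^sub>F \<nu> in sequentially. K \<le> Max (S \<nu>)"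
      using ev[of K] eventually_ge_at_top[of K]
      by eventually_elim (rule Max_ge[OF S(1)], simp add: S_def)
  qed
  moreover have "\<forall>\<^sub>F \<nu> in sequentially. Q (Max (S \<nu>)) \<nu>"
    using ev[of 0]
  proof eventually_elim
    case (elim \<nu>)
    have "Max (S \<nu>) \<in> S \<nu>" by (rule Max_in[OF S])
    then show ?case unfolding S_def using elim by (auto simp: S_def)
  qed
  ultimately show ?thesis by blast
qed

lemma epi_nonempty:
  assumes "f \<in> lsc_fcns X"
  shows "epi X f \<noteq> {}"
proof -
  obtain x where "x \<in> X" "f x \<noteq> \<infinity>" using assms by (auto simp: lsc_fcns_def fcns_def)
  then obtain t where "f x \<le> ereal t" by (cases "f x") auto
  with \<open>x \<in> X\<close> show ?thesis by (auto simp: epi_def)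
qed

text \<open>
  Both halves express convergence of the distance functions to the epigraphs. If \<open>f\<^sub>\<nu>(z\<^sub>\<nu>) \<le> t < f(x)\<close>
  occurred infinitely often along \<open>z\<^sub>\<nu> \<rightarrow> x\<close>, then \<open>(x, t)\<close> would have distance zero from the closed
  epigraph of \<open>f\<close>. Conversely, points of the epigraph of \<open>f\<close> above \<open>x\<close> are approached by points of the
  epigraphs of \<open>f\<^sub>\<nu>\<close>, whose first components form a recovery sequence.
\<close>

lemma AW_conv_imp_epi_conv:
  fixes X :: "'a::euclidean_space set"
  assumes X: "closed X" and zctr: "zctr \<in> X \<times> UNIV"
    and fs: "\<And>\<nu>. fs \<nu> \<in> lsc_fcns X" and f: "f \<in> lsc_fcns X"
    and lim: "(\<lambda>\<nu>. AW_dist zctr X (fs \<nu>) f) \<longlonglongrightarrow> 0"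
  shows "epi_conv X fs f"
proof -
  have unif: "\<forall>\<^sub>F \<nu> in sequentially. \<forall>z\<in>X \<times> UNIV. dist z zctr \<le> \<rho> \<longrightarrow>
      \<bar>infdist z (epi X (fs \<nu>)) - infdist z (epi X f)\<bar> < e" if e: "0 < e" for \<rho> e
  proof -
    have "\<forall>\<^sub>F \<nu> in sequentially. AW_dist zctr X (fs \<nu>) f < e * exp (- (\<rho> + 1))"
      using order_tendstoD(2)[OF lim] e by simp
    then show ?thesis
    proof eventually_elim
      case (elim \<nu>)
      show ?case
      proof (intro ballI impI)
        fix z assume z: "z \<in> X \<times> UNIV" "dist z zctr \<le> \<rho>"
        have "\<bar>infdist z (epi X (fs \<nu>)) - infdist z (epi X f)\<bar> * exp (- (\<rho> + 1)) < e * exp (- (\<rho> + 1))"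
          using infdist_diff_le_AW_dist[OF zctr z] elim by (rule le_less_trans)
        then show "\<bar>infdist z (epi X (fs \<nu>)) - infdist z (epi X f)\<bar> < e" by simp
      qed
    qed
  qed
  have closed: "closed (epi X g)" if "g \<in> lsc_fcns X" for g
    using closed_epi[OF X] that by (simp add: lsc_fcns_def)
  have lower: "f x \<le> liminf (\<lambda>\<nu>. fs \<nu> (zs \<nu>))"
    if x: "x \<in> X" and zs: "\<And>\<nu>. zs \<nu> \<in> X" "zs \<longlonglongrightarrow> x" for x zs
    unfolding le_Liminf_iff
  proof (intro allI impI)
    fix y assume "y < f x"
    then obtain t where t: "y < ereal t" "ereal t < f x" using ereal_dense2 by blast
    have "(x, t) \<notin> epi X f" using t(2) by (auto simp: epi_def)
    then have d: "0 < infdist (x, t) (epi X f)"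
      using in_closed_iff_infdist_zero[OF closed[OF f] epi_nonempty[OF f], of "(x, t)"]
        infdist_nonneg[of "(x, t)" "epi X f"] by linarith
    define \<rho> where "\<rho> = dist (x, t) zctr + 1"
    have zt: "(\<lambda>\<nu>. (zs \<nu>, t)) \<longlonglongrightarrow> (x, t)" by (intro tendsto_intros zs(2))
    have "(\<lambda>\<nu>. dist (zs \<nu>, t) zctr) \<longlonglongrightarrow> dist (x, t) zctr" by (intro tendsto_intros zt)
    then have "\<forall>\<^sub>F \<nu> in sequentially. dist (zs \<nu>, t) zctr < \<rho>"
      by (rule order_tendstoD) (simp add: \<rho>_def)
    moreover have "(\<lambda>\<nu>. infdist (zs \<nu>, t) (epi X f)) \<longlonglongrightarrow> infdist (x, t) (epi X f)"
      by (intro tendsto_infdist zt)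
    then have "\<forall>\<^sub>F \<nu> in sequentially. infdist (x, t) (epi X f) / 2 < infdist (zs \<nu>, t) (epi X f)"
      by (rule order_tendstoD) (use d in simp)
    ultimately show "\<forall>\<^sub>F \<nu> in sequentially. y < fs \<nu> (zs \<nu>)"
      using unif[OF half_gt_zero[OF d], of \<rho>]
    proof eventually_elim
      case (elim \<nu>)
      have "\<bar>infdist (zs \<nu>, t) (epi X (fs \<nu>)) - infdist (zs \<nu>, t) (epi X f)\<bar> < infdist (x, t) (epi X f) / 2"
        using elim(1,3) zs(1)[of \<nu>] by simp
      then have "infdist (zs \<nu>, t) (epi X (fs \<nu>)) \<noteq> 0" using elim(2) by linarith
      then have "(zs \<nu>, t) \<notin> epi X (fs \<nu>)" using infdist_zero by blast
      then have "ereal t < fs \<nu> (zs \<nu>)" using zs(1)[of \<nu>] by (auto simp: epi_def)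
      with t(1) show ?case by order
    qed
  qed
  have upper: "\<exists>zs. (\<forall>\<nu>. zs \<nu> \<in> X) \<and> zs \<longlonglongrightarrow> x \<and> limsup (\<lambda>\<nu>. fs \<nu> (zs \<nu>)) \<le> f x" if x: "x \<in> X" for x
  proof (cases "f x = \<infinity>")
    case True
    then show ?thesis using x by (intro exI[of _ "\<lambda>_. x"]) auto
  next
    case False
    \<comment> \<open>The heights \<open>c k\<close> decrease to \<open>f x\<close>, also when \<open>f x = -\<infinity>\<close>, and each bounds \<open>f x\<close> from above.\<close>
    define c where "c k = real_of_ereal (max (f x) (ereal (- real k)))" for k
    have c: "ereal (c k) = max (f x) (ereal (- real k))" for k
      using False by (cases "f x") (auto simp: c_def max_def)
    define r where "r k = inverse (real (Suc k))" for k
    have r: "0 < r k" for k by (simp add: r_def)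
    have r_lim: "r \<longlonglongrightarrow> 0" unfolding r_def by (rule LIMSEQ_inverse_real_of_nat)
    have c_lim: "(\<lambda>k. ereal (c k) + ereal (r k)) \<longlonglongrightarrow> f x"
    proof -
      have "(\<lambda>k. ereal (- real k)) \<longlonglongrightarrow> - \<infinity>"
        using tendsto_uminus_ereal[OF id_nat_ereal_tendsto_PInf] by simp
      then have "(\<lambda>k. max (f x) (ereal (- real k))) \<longlonglongrightarrow> max (f x) (- \<infinity>)"
        by (intro tendsto_max tendsto_const)
      moreover have "(\<lambda>k. ereal (r k)) \<longlonglongrightarrow> ereal 0" using r_lim by simp
      ultimately have "(\<lambda>k. max (f x) (ereal (- real k)) + ereal (r k)) \<longlonglongrightarrow> max (f x) (- \<infinity>) + ereal 0"
        by (intro tendsto_add_ereal_general1) auto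
      then show ?thesis unfolding c by (simp add: max_def)
    qed
    define Q where "Q k \<nu> \<longleftrightarrow> infdist (x, c k) (epi X (fs \<nu>)) < r k" for k \<nu>
    have "\<forall>\<^sub>F \<nu> in sequentially. Q k \<nu>" for k
    proof -
      have "(x, c k) \<in> epi X f" using x c[of k] by (auto simp: epi_def)
      then have zero: "infdist (x, c k) (epi X f) = 0" by (rule infdist_zero)
      have mem: "(x, c k) \<in> X \<times> UNIV" using x by simp
      have "\<forall>\<^sub>F \<nu> in sequentially.
          \<bar>infdist (x, c k) (epi X (fs \<nu>)) - infdist (x, c k) (epi X f)\<bar> < r k"
        using unif[OF r, of "dist (x, c k) zctr" k] by eventually_elim (drule bspec[OF _ mem], simp)
      then show ?thesis unfolding Q_def by eventually_elim (use zero in linarith)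
    qed
    from eventually_diagonal[of Q, OF this] obtain \<kappa> where \<kappa>: "filterlim \<kappa> at_top sequentially" "\<forall>\<^sub>F \<nu> in sequentially. Q (\<kappa> \<nu>) \<nu>"
      by (elim exE conjE)
    have "\<exists>z. z \<in> X \<and> (Q (\<kappa> \<nu>) \<nu> \<longrightarrow>
        dist z x \<le> r (\<kappa> \<nu>) \<and> fs \<nu> z \<le> ereal (c (\<kappa> \<nu>)) + ereal (r (\<kappa> \<nu>)))" for \<nu>
    proof (cases "Q (\<kappa> \<nu>) \<nu>")
      case True
      obtain p where p: "p \<in> epi X (fs \<nu>)" "infdist (x, c (\<kappa> \<nu>)) (epi X (fs \<nu>)) = dist (x, c (\<kappa> \<nu>)) p"
        by (rule infdist_attains_inf[OF closed[OF fs] epi_nonempty[OF fs]])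
      have "dist (fst p) x \<le> dist (x, c (\<kappa> \<nu>)) p" "dist (c (\<kappa> \<nu>)) (snd p) \<le> dist (x, c (\<kappa> \<nu>)) p"
        using dist_fst_le[of p "(x, c (\<kappa> \<nu>))"] dist_snd_le[of "(x, c (\<kappa> \<nu>))" p]
        by (simp_all add: dist_commute)
      with True p(2) have "dist (fst p) x \<le> r (\<kappa> \<nu>)" "snd p \<le> c (\<kappa> \<nu>) + r (\<kappa> \<nu>)"
        by (auto simp: Q_def dist_real_def)
      moreover have "fst p \<in> X" and fs_p: "fs \<nu> (fst p) \<le> ereal (snd p)"
        using p(1) by (auto simp: epi_def)
      moreover have "fs \<nu> (fst p) \<le> ereal (c (\<kappa> \<nu>)) + ereal (r (\<kappa> \<nu>))"
        by (rule order_trans[OF fs_p]) (use \<open>snd p \<le> c (\<kappa> \<nu>) + r (\<kappa> \<nu>)\<close> in simp)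
      ultimately show ?thesis by blast
    qed (use x in \<open>simp add: exI[of _ x]\<close>)
    then have "\<exists>zs. \<forall>\<nu>. zs \<nu> \<in> X \<and> (Q (\<kappa> \<nu>) \<nu> \<longrightarrow>
        dist (zs \<nu>) x \<le> r (\<kappa> \<nu>) \<and> fs \<nu> (zs \<nu>) \<le> ereal (c (\<kappa> \<nu>)) + ereal (r (\<kappa> \<nu>)))"
      by (intro choice allI)
    then obtain zs where zs_all: "\<forall>\<nu>. zs \<nu> \<in> X \<and> (Q (\<kappa> \<nu>) \<nu> \<longrightarrow>
        dist (zs \<nu>) x \<le> r (\<kappa> \<nu>) \<and> fs \<nu> (zs \<nu>) \<le> ereal (c (\<kappa> \<nu>)) + ereal (r (\<kappa> \<nu>)))" ..
    then have zs: "zs \<nu> \<in> X" "Q (\<kappa> \<nu>) \<nu> \<Longrightarrow> dist (zs \<nu>) x \<le> r (\<kappa> \<nu>)"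
      "Q (\<kappa> \<nu>) \<nu> \<Longrightarrow> fs \<nu> (zs \<nu>) \<le> ereal (c (\<kappa> \<nu>)) + ereal (r (\<kappa> \<nu>))" for \<nu>
      by blast+
    have "(\<lambda>\<nu>. dist (zs \<nu>) x) \<longlonglongrightarrow> 0"
    proof (rule tendsto_sandwich[where f = "\<lambda>_. 0"])
      show "\<forall>\<^sub>F \<nu> in sequentially. dist (zs \<nu>) x \<le> r (\<kappa> \<nu>)"
        using \<kappa>(2) by eventually_elim (rule zs(2))
      show "(\<lambda>\<nu>. r (\<kappa> \<nu>)) \<longlonglongrightarrow> 0" by (rule filterlim_compose[OF r_lim \<kappa>(1)])
    qed simp_all
    then have "zs \<longlonglongrightarrow> x" by (rule iffD2[OF tendsto_dist_iff])
    moreover have "limsup (\<lambda>\<nu>. fs \<nu> (zs \<nu>)) \<le> f x"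
    proof -
      have "\<forall>\<^sub>F \<nu> in sequentially. fs \<nu> (zs \<nu>) \<le> ereal (c (\<kappa> \<nu>)) + ereal (r (\<kappa> \<nu>))"
        using \<kappa>(2) by eventually_elim (rule zs(3))
      then have "limsup (\<lambda>\<nu>. fs \<nu> (zs \<nu>)) \<le> limsup (\<lambda>\<nu>. ereal (c (\<kappa> \<nu>)) + ereal (r (\<kappa> \<nu>)))"
        by (rule Limsup_mono)
      also have "\<dots> = f x"
        by (rule lim_imp_Limsup[OF _ filterlim_compose[OF c_lim \<kappa>(1)]]) simp
      finally show ?thesis .
    qed
    ultimately show ?thesis by (intro exI[of _ zs] conjI allI zs(1))
  qed
  show ?thesis
    unfolding epi_conv_def by (intro ballI conjI allI impI upper lower) blast+
qed

section \<open>Convergence of the one-stage values\<close>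

text \<open>
  Pointwise convergence of the objectives bounds the limit of the infima from above, by testing with
  a single decision \<open>y\<close>. For the lower bound, decisions with values below some \<open>c\<close> along a subsequence
  accumulate at a point of the compact set \<open>Y x \<xi>\<close>, where epi-convergence keeps the limiting objective
  at most \<open>c\<close>.
\<close>

lemma bellman_b_tendsto:
  fixes X :: "'a::euclidean_space set" and \<Xi> :: "'b::metric_space set"
  assumes \<beta>: "0 < \<beta>"
    and Y: "Y x \<xi> \<subseteq> X" "compact (Y x \<xi>)" and x: "x \<in> X" and \<xi>: "\<xi> \<in> \<Xi>"
    and \<phi>epi: "epi_conv (X \<times> X \<times> \<Xi>) (\<lambda>\<nu> z. ereal (\<phi>s \<nu> z)) (\<lambda>z. ereal (\<phi> z))"
    and \<phi>lim: "\<And>z. z \<in> X \<times> X \<times> \<Xi> \<Longrightarrow> (\<lambda>\<nu>. \<phi>s \<nu> z) \<longlonglongrightarrow> \<phi> z"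
    and Vepi: "epi_conv X Vs W" and Vlim: "\<And>y. y \<in> X \<Longrightarrow> (\<lambda>\<nu>. Vs \<nu> y) \<longlonglongrightarrow> W y"
  shows "(\<lambda>\<nu>. bellman_b Y \<beta> (\<phi>s \<nu>) (Vs \<nu>) (x, \<xi>)) \<longlonglongrightarrow> bellman_b Y \<beta> \<phi> W (x, \<xi>)"
proof -
  define q where "q \<nu> y = ereal (\<phi>s \<nu> (x, y, \<xi>)) + ereal \<beta> * Vs \<nu> y" for \<nu> y
  define q\<^sub>0 where "q\<^sub>0 y = ereal (\<phi> (x, y, \<xi>)) + ereal \<beta> * W y" for y
  have qlim: "(\<lambda>\<nu>. q \<nu> y) \<longlonglongrightarrow> q\<^sub>0 y" if "y \<in> Y x \<xi>" for y
  proof -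
    have y: "y \<in> X" using that Y(1) by blast
    have "(\<lambda>\<nu>. ereal (\<phi>s \<nu> (x, y, \<xi>))) \<longlonglongrightarrow> ereal (\<phi> (x, y, \<xi>))"
      using \<phi>lim[of "(x, y, \<xi>)"] x y \<xi> by simp
    moreover have "(\<lambda>\<nu>. ereal \<beta> * Vs \<nu> y) \<longlonglongrightarrow> ereal \<beta> * W y"
      using Vlim[OF y] by (intro tendsto_cmult_ereal) auto
    ultimately show ?thesis unfolding q_def q\<^sub>0_def by (intro tendsto_add_ereal_general2) auto
  qed
  have "(\<lambda>\<nu>. INF y\<in>Y x \<xi>. q \<nu> y) \<longlonglongrightarrow> (INF y\<in>Y x \<xi>. q\<^sub>0 y)"
  proof (rule order_tendstoI)
    fix a assume "(INF y\<in>Y x \<xi>. q\<^sub>0 y) < a"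
    then obtain y where y: "y \<in> Y x \<xi>" "q\<^sub>0 y < a" by (auto simp: INF_less_iff)
    show "\<forall>\<^sub>F \<nu> in sequentially. (INF y\<in>Y x \<xi>. q \<nu> y) < a"
      using order_tendstoD(2)[OF qlim[OF y(1)] y(2)]
      by eventually_elim (use y(1) in \<open>auto simp: INF_less_iff\<close>)
  next
    fix a assume "a < (INF y\<in>Y x \<xi>. q\<^sub>0 y)"
    then obtain c where c: "a < c" "c < (INF y\<in>Y x \<xi>. q\<^sub>0 y)" using dense by blast
    show "\<forall>\<^sub>F \<nu> in sequentially. a < (INF y\<in>Y x \<xi>. q \<nu> y)"
    proof (rule ccontr)
      assume "\<not> (\<forall>\<^sub>F \<nu> in sequentially. a < (INF y\<in>Y x \<xi>. q \<nu> y))"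
      then have "\<exists>\<^sub>F \<nu> in sequentially. (INF y\<in>Y x \<xi>. q \<nu> y) \<le> a"
        by (simp add: not_eventually not_less)
      then have "\<exists>\<^sub>\<infinity>\<nu>. (INF y\<in>Y x \<xi>. q \<nu> y) < c"
        unfolding cofinite_eq_sequentially[symmetric] by (rule frequently_elim1) (use c(1) in order)
      then obtain r :: "nat \<Rightarrow> nat" where r: "strict_mono r" "\<And>k. (INF y\<in>Y x \<xi>. q (r k) y) < c"
        using infinite_enumerate[of "{\<nu>. (INF y\<in>Y x \<xi>. q \<nu> y) < c}"]
        by (auto simp: INFM_iff_infinite)
      have "\<exists>y. y \<in> Y x \<xi> \<and> q (r k) y < c" for k using r(2)[of k] by (auto simp: INF_less_iff)
      then obtain ys where ys: "\<And>k. ys k \<in> Y x \<xi>" "\<And>k. q (r k) (ys k) < c" by metis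
      obtain y s where y: "y \<in> Y x \<xi>" and s: "strict_mono s" "(ys \<circ> s) \<longlonglongrightarrow> y"
        using Y(2) ys(1) unfolding compact_def by metis
      have ys_lim: "(\<lambda>k. ys (s k)) \<longlonglongrightarrow> y" using s(2) by (simp only: o_def)
      have rs: "strict_mono (r \<circ> s)" using r(1) s(1) by (rule strict_mono_o)
      have yX: "y \<in> X" "\<And>k. ys k \<in> X" using y ys(1) Y(1) by auto
      have "ereal (\<phi> (x, y, \<xi>)) \<le> liminf (\<lambda>k. ereal (\<phi>s ((r \<circ> s) k) (x, (ys \<circ> s) k, \<xi>)))"
        by (rule epi_conv_liminf_subseq[OF \<phi>epi rs])
          (use x \<xi> yX ys_lim in \<open>auto intro!: tendsto_intros\<close>)
      moreover have "W y \<le> liminf (\<lambda>k. Vs ((r \<circ> s) k) ((ys \<circ> s) k))"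
        by (rule epi_conv_liminf_subseq[OF Vepi rs]) (use yX ys_lim in auto)
      then have "ereal \<beta> * W y \<le> ereal \<beta> * liminf (\<lambda>k. Vs ((r \<circ> s) k) ((ys \<circ> s) k))"
        using \<beta> by (intro ereal_mult_left_mono) auto
      moreover have "\<dots> = liminf (\<lambda>k. ereal \<beta> * Vs ((r \<circ> s) k) ((ys \<circ> s) k))"
        using \<beta> by (intro Liminf_ereal_mult_left[symmetric]) auto
      ultimately have *: "ereal (\<phi> (x, y, \<xi>)) \<le> liminf (\<lambda>k. ereal (\<phi>s ((r \<circ> s) k) (x, (ys \<circ> s) k, \<xi>)))"
        "ereal \<beta> * W y \<le> liminf (\<lambda>k. ereal \<beta> * Vs ((r \<circ> s) k) ((ys \<circ> s) k))" by simp_all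
      have "q\<^sub>0 y \<le> liminf (\<lambda>k. q ((r \<circ> s) k) ((ys \<circ> s) k))"
      \<comment> \<open>Superadditivity of liminf needs the sum of the two lower limits to be well defined.\<close>
      proof (cases "W y = - \<infinity>")
        case True
        then show ?thesis using \<beta> by (simp add: q\<^sub>0_def)
      next
        case False
        then have "ereal \<beta> * W y \<noteq> - \<infinity>" using \<beta> by (cases "W y") auto
        then have "liminf (\<lambda>k. ereal (\<phi>s ((r \<circ> s) k) (x, (ys \<circ> s) k, \<xi>))) +
              liminf (\<lambda>k. ereal \<beta> * Vs ((r \<circ> s) k) ((ys \<circ> s) k))
            \<le> liminf (\<lambda>k. q ((r \<circ> s) k) ((ys \<circ> s) k))"
          unfolding q_def using * by (intro ereal_liminf_add_mono) auto
        then show ?thesis unfolding q\<^sub>0_def using add_mono[OF *] by (rule order_trans[rotated])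
      qed
      also have "\<dots> \<le> c"
        by (rule Liminf_le) (use ys(2) in \<open>auto intro!: always_eventually less_imp_le\<close>)
      finally have "q\<^sub>0 y \<le> c" .
      moreover have "(INF y\<in>Y x \<xi>. q\<^sub>0 y) \<le> q\<^sub>0 y" by (rule INF_lower[OF y])
      ultimately show False using c(2) by order
    qed
  qed
  then show ?thesis by (simp add: bellman_b_def q_def q\<^sub>0_def)
qed

section \<open>Weak convergence with varying bounded integrands\<close>

lemma space_borel_distribution:
  assumes "borel_distribution \<Xi> P"
  shows "space P = \<Xi>"
proof -
  have "sets P = sets (restrict_space borel \<Xi>)" using assms by (simp add: borel_distribution_def)
  from sets_eq_imp_space_eq[OF this] show ?thesis by (simp add: space_restrict_space)
qed

lemma continuous_on_borel_distribution:
  assumes "borel_distribution \<Xi> P" "continuous_on \<Xi> h"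
  shows "h \<in> borel_measurable P"
  using borel_measurable_continuous_on_restrict[OF assms(2)] assms(1)
    measurable_cong_sets[of P "restrict_space borel \<Xi>" borel borel]
  unfolding borel_distribution_def by blast

text \<open>
  The continuous cut-offs \<open>min 1 (max 0 (norm \<xi> - R))\<close> have small expectation under \<open>P\<close> for large \<open>R\<close>,
  hence eventually under \<open>Ps \<nu>\<close>, and they dominate the indicator of \<open>norm \<xi> > R + 1\<close>.
\<close>

lemma weak_conv_on_tight:
  fixes \<Xi> :: "'b::euclidean_space set"
  assumes P: "borel_distribution \<Xi> P" and Ps: "\<And>\<nu>. borel_distribution \<Xi> (Ps \<nu>)"
    and weak: "weak_conv_on \<Xi> Ps P" and e: "0 < e"
  shows "\<exists>R. \<forall>\<^sub>F \<nu> in sequentially. measure (Ps \<nu>) {\<xi>\<in>\<Xi>. R < norm \<xi>} < e"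
proof -
  interpret P: prob_space P using P by (simp add: borel_distribution_def)
  define h where "h R \<xi> = min 1 (max 0 (norm \<xi> - R))" for R and \<xi> :: 'b
  have h_cont: "continuous_on A (h R)" for R A
    unfolding h_def by (intro continuous_intros)
  have h_bd: "0 \<le> h R \<xi>" "h R \<xi> \<le> 1" for R \<xi> by (auto simp: h_def)
  have int_h: "integrable M (h R)" if M: "borel_distribution \<Xi> M" for M R
  proof -
    interpret prob_space M using M by (simp add: borel_distribution_def)
    show ?thesis
      by (rule integrable_const_bound[of _ 1])
        (use h_bd continuous_on_borel_distribution[OF M h_cont] in auto)
  qed
  have "(\<lambda>k. \<integral>\<xi>. h (real k) \<xi> \<partial>P) \<longlonglongrightarrow> (\<integral>\<xi>. 0 \<partial>P)"
  proof (rule integral_dominated_convergence[where w = "\<lambda>_. 1"])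
    show "AE \<xi> in P. (\<lambda>k. h (real k) \<xi>) \<longlonglongrightarrow> 0"
    proof (rule AE_I2)
      fix \<xi> :: 'b
      obtain N :: nat where N: "norm \<xi> \<le> real N" using real_arch_simple by blast
      have "h (real k) \<xi> = 0" if "N \<le> k" for k using N that by (simp add: h_def)
      then show "(\<lambda>k. h (real k) \<xi>) \<longlonglongrightarrow> 0"
        by (intro tendsto_eventually) (auto simp: eventually_sequentially)
    qed
  qed (use h_bd continuous_on_borel_distribution[OF P h_cont] in auto)
  then have "\<forall>\<^sub>F k in sequentially. (\<integral>\<xi>. h (real k) \<xi> \<partial>P) < e"
    using e by (auto dest: order_tendstoD)
  then obtain k :: nat where k: "(\<integral>\<xi>. h (real k) \<xi> \<partial>P) < e" by (auto simp: eventually_sequentially)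
  have "(\<lambda>\<nu>. \<integral>\<xi>. h (real k) \<xi> \<partial>Ps \<nu>) \<longlonglongrightarrow> (\<integral>\<xi>. h (real k) \<xi> \<partial>P)"
  proof -
    have "bounded (h (real k) ` \<Xi>)" using h_bd by (auto simp: bounded_iff intro!: exI[of _ "1::real"])
    then show ?thesis using weak h_cont unfolding weak_conv_on_def by blast
  qed
  from order_tendstoD(2)[OF this k]
  have "\<forall>\<^sub>F \<nu> in sequentially. measure (Ps \<nu>) {\<xi>\<in>\<Xi>. real k + 1 < norm \<xi>} < e"
  proof eventually_elim
    case (elim \<nu>)
    interpret prob_space "Ps \<nu>" using Ps by (simp add: borel_distribution_def)
    have sets: "{\<xi>\<in>\<Xi>. real k + 1 < norm \<xi>} \<in> sets (Ps \<nu>)"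
    proof -
      have "norm \<in> borel_measurable (Ps \<nu>)"
        by (rule continuous_on_borel_distribution[OF Ps]) (intro continuous_intros)
      then have "{\<xi>\<in>space (Ps \<nu>). real k + 1 < norm \<xi>} \<in> sets (Ps \<nu>)" by measurable
      then show ?thesis by (simp add: space_borel_distribution[OF Ps])
    qed
    have "measure (Ps \<nu>) {\<xi>\<in>\<Xi>. real k + 1 < norm \<xi>} =
        (\<integral>\<xi>. indicator {\<xi>\<in>\<Xi>. real k + 1 < norm \<xi>} \<xi> \<partial>Ps \<nu>)"
      using sets by (simp add: emeasure_eq_measure)
    also have "\<dots> \<le> (\<integral>\<xi>. h (real k) \<xi> \<partial>Ps \<nu>)"
    proof (rule integral_mono[OF _ int_h[OF Ps]])
      show "integrable (Ps \<nu>) (indicator {\<xi>\<in>\<Xi>. real k + 1 < norm \<xi>} :: 'b \<Rightarrow> real)"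
        using sets by (simp add: emeasure_eq_measure)
      show "indicator {\<xi>\<in>\<Xi>. real k + 1 < norm \<xi>} \<xi> \<le> h (real k) \<xi>" for \<xi>
        by (simp add: indicator_def h_def)
    qed
    finally show ?case using elim by simp
  qed
  then show ?thesis by blast
qed

text \<open>
  Replacing \<open>fs \<nu>\<close> by its limit \<open>f\<close> under \<open>Ps \<nu>\<close> costs little: on a large compact set the convergence is
  uniform, and by tightness the rest carries little mass. Since \<open>f\<close> is continuous and bounded, weak
  convergence applies to it.
\<close>

lemma weak_conv_on_cont_conv_integral:
  fixes \<Xi> :: "'b::euclidean_space set" and fs :: "nat \<Rightarrow> 'b \<Rightarrow> real"
  assumes \<Xi>: "closed \<Xi>" and P: "borel_distribution \<Xi> P" and Ps: "\<And>\<nu>. borel_distribution \<Xi> (Ps \<nu>)"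
    and weak: "weak_conv_on \<Xi> Ps P"
    and meas: "\<And>\<nu>. fs \<nu> \<in> borel_measurable (Ps \<nu>)"
    and bd: "\<And>\<nu> \<xi>. \<bar>fs \<nu> \<xi>\<bar> \<le> C" "\<And>\<xi>. \<bar>f \<xi>\<bar> \<le> C"
    and cc: "cont_conv \<Xi> fs f"
  shows "(\<lambda>\<nu>. \<integral>\<xi>. fs \<nu> \<xi> \<partial>Ps \<nu>) \<longlonglongrightarrow> (\<integral>\<xi>. f \<xi> \<partial>P)"
proof -
  have f_cont: "continuous_on \<Xi> f" by (rule cont_conv_continuous_limit[OF cc])
  have C: "0 \<le> C" using bd(2)[of undefined] by linarith
  have "(\<lambda>\<nu>. (\<integral>\<xi>. fs \<nu> \<xi> \<partial>Ps \<nu>) - (\<integral>\<xi>. f \<xi> \<partial>Ps \<nu>)) \<longlonglongrightarrow> 0"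
  proof (rule tendstoI)
    fix e :: real assume e: "0 < e"
    define \<eta> where "\<eta> = e / (2 * (2 * C + 1))"
    have \<eta>: "0 < \<eta>" "2 * C * \<eta> < e / 2" using e C by (auto simp: \<eta>_def field_simps)
    obtain R where R: "\<forall>\<^sub>F \<nu> in sequentially. measure (Ps \<nu>) {\<xi>\<in>\<Xi>. R < norm \<xi>} < \<eta>"
      using weak_conv_on_tight[OF P Ps weak \<eta>(1)] by blast
    have "compact (\<Xi> \<inter> cball 0 R)" using \<Xi> by (simp add: closed_Int_compact)
    then have "\<forall>\<^sub>F \<nu> in sequentially. \<forall>\<xi>\<in>\<Xi> \<inter> cball 0 R. \<bar>fs \<nu> \<xi> - f \<xi>\<bar> < e / 2"
      by (rule cont_conv_uniform_on_compact[OF cc]) (use e in auto)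
    with R show "\<forall>\<^sub>F \<nu> in sequentially.
        dist ((\<integral>\<xi>. fs \<nu> \<xi> \<partial>Ps \<nu>) - (\<integral>\<xi>. f \<xi> \<partial>Ps \<nu>)) 0 < e"
    proof eventually_elim
      case (elim \<nu>)
      interpret prob_space "Ps \<nu>" using Ps by (simp add: borel_distribution_def)
      let ?T = "{\<xi>\<in>\<Xi>. R < norm \<xi>}"
      have T: "?T \<in> sets (Ps \<nu>)"
      proof -
        have "norm \<in> borel_measurable (Ps \<nu>)"
          by (rule continuous_on_borel_distribution[OF Ps]) (intro continuous_intros)
        then have "{\<xi>\<in>space (Ps \<nu>). R < norm \<xi>} \<in> sets (Ps \<nu>)" by measurable
        then show ?thesis by (simp add: space_borel_distribution[OF Ps])
      qed
      have int: "integrable (Ps \<nu>) (fs \<nu>)" "integrable (Ps \<nu>) f"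
        using continuous_on_borel_distribution[OF Ps f_cont] meas bd
        by (auto intro!: integrable_const_bound[of _ C])
      have "\<bar>(\<integral>\<xi>. fs \<nu> \<xi> \<partial>Ps \<nu>) - (\<integral>\<xi>. f \<xi> \<partial>Ps \<nu>)\<bar> = \<bar>\<integral>\<xi>. fs \<nu> \<xi> - f \<xi> \<partial>Ps \<nu>\<bar>"
        using int by simp
      also have "\<dots> \<le> (\<integral>\<xi>. \<bar>fs \<nu> \<xi> - f \<xi>\<bar> \<partial>Ps \<nu>)" by (rule integral_abs_bound)
      also have "\<dots> \<le> (\<integral>\<xi>. e / 2 + 2 * C * indicator ?T \<xi> \<partial>Ps \<nu>)"
      proof (rule integral_mono)
        show "integrable (Ps \<nu>) (\<lambda>\<xi>. \<bar>fs \<nu> \<xi> - f \<xi>\<bar>)" using int by simp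
        show "integrable (Ps \<nu>) (\<lambda>\<xi>. e / 2 + 2 * C * indicator ?T \<xi>)"
          using T by (auto simp: emeasure_eq_measure)
        fix \<xi> assume "\<xi> \<in> space (Ps \<nu>)"
        then have \<xi>: "\<xi> \<in> \<Xi>" by (simp add: space_borel_distribution[OF Ps])
        show "\<bar>fs \<nu> \<xi> - f \<xi>\<bar> \<le> e / 2 + 2 * C * indicator ?T \<xi>"
        proof (cases "R < norm \<xi>")
          case True
          then show ?thesis using bd(1)[of \<nu> \<xi>] bd(2)[of \<xi>] \<xi> e by simp
        next
          case False
          then show ?thesis using elim(2) \<xi> by (force intro: less_imp_le)
        qed
      qed
      also have "\<dots> = e / 2 + 2 * C * measure (Ps \<nu>) ?T"
        using T by (subst Bochner_Integration.integral_add) (auto simp: emeasure_eq_measure prob_space)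
      also have "\<dots> \<le> e / 2 + 2 * C * \<eta>"
        using elim(1) C by (intro add_left_mono mult_left_mono) auto
      also have "\<dots> < e" using \<eta>(2) by simp
      finally show ?case by (simp add: dist_real_def)
    qed
  qed
  moreover have "(\<lambda>\<nu>. \<integral>\<xi>. f \<xi> \<partial>Ps \<nu>) \<longlonglongrightarrow> (\<integral>\<xi>. f \<xi> \<partial>P)"
  proof -
    have "bounded (f ` \<Xi>)" using bd(2) by (auto simp: bounded_iff)
    then show ?thesis using weak f_cont unfolding weak_conv_on_def by blast
  qed
  ultimately have "(\<lambda>\<nu>. ((\<integral>\<xi>. fs \<nu> \<xi> \<partial>Ps \<nu>) - (\<integral>\<xi>. f \<xi> \<partial>Ps \<nu>)) + (\<integral>\<xi>. f \<xi> \<partial>Ps \<nu>))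
      \<longlonglongrightarrow> 0 + (\<integral>\<xi>. f \<xi> \<partial>P)" by (rule tendsto_add)
  then show ?thesis by simp
qed

section \<open>Extended-real expectations under asymptotically vanishing tails\<close>

lemma ext_integrable_AE_finite:
  assumes "ext_integrable M h"
  shows "AE \<xi> in M. \<bar>h \<xi>\<bar> \<noteq> \<infinity>"
proof -
  have [measurable]: "h \<in> borel_measurable M" using assms by (simp add: ext_integrable_def)
  have "AE \<xi> in M. e2ennreal \<bar>h \<xi>\<bar> \<noteq> \<infinity>"
    using assms unfolding ext_integrable_def by (intro nn_integral_PInf_AE) auto
  then show ?thesis by eventually_elim auto
qed

lemma ext_integrable_imp_integrable:
  assumes h: "ext_integrable M h"
  shows "integrable M (\<lambda>\<xi>. real_of_ereal (h \<xi>))"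
proof (rule integrableI_bounded)
  have [measurable]: "h \<in> borel_measurable M" using h by (simp add: ext_integrable_def)
  show "(\<lambda>\<xi>. real_of_ereal (h \<xi>)) \<in> borel_measurable M" by measurable
  have "(\<integral>\<^sup>+\<xi>. ennreal (norm (real_of_ereal (h \<xi>))) \<partial>M) \<le> (\<integral>\<^sup>+\<xi>. e2ennreal \<bar>h \<xi>\<bar> \<partial>M)"
  proof (rule nn_integral_mono)
    show "ennreal (norm (real_of_ereal (h \<xi>))) \<le> e2ennreal \<bar>h \<xi>\<bar>" for \<xi> by (cases "h \<xi>") auto
  qed
  also have "\<dots> < \<infinity>" using h by (simp add: ext_integrable_def)
  finally show "(\<integral>\<^sup>+\<xi>. ennreal (norm (real_of_ereal (h \<xi>))) \<partial>M) < \<infinity>" .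
qed

text \<open>
  An integrable function is finite almost everywhere, so sending infinite values to 0 changes nothing
  and the Bochner integral is available.
\<close>

lemma ext_expectation_eq_integral:
  assumes h: "ext_integrable M h"
  shows "ext_expectation M h = ereal (\<integral>\<xi>. real_of_ereal (h \<xi>) \<partial>M)"
proof -
  note int = ext_integrable_imp_integrable[OF h]
  have pos: "(\<integral>\<^sup>+\<xi>. e2ennreal (h \<xi>) \<partial>M) = (\<integral>\<^sup>+\<xi>. ennreal (real_of_ereal (h \<xi>)) \<partial>M)"
    using ext_integrable_AE_finite[OF h]
    by (intro nn_integral_cong_AE) (auto elim!: eventually_mono)
  have neg: "(\<integral>\<^sup>+\<xi>. e2ennreal (- h \<xi>) \<partial>M) = (\<integral>\<^sup>+\<xi>. ennreal (- real_of_ereal (h \<xi>)) \<partial>M)"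
    using ext_integrable_AE_finite[OF h]
    by (intro nn_integral_cong_AE) (auto elim!: eventually_mono)
  have *: "enn2ereal x = ereal (enn2real x)" if "x < \<infinity>" for x
    using that by (cases x) (auto simp: enn2ereal_ennreal)
  have fin: "(\<integral>\<^sup>+\<xi>. ennreal (real_of_ereal (h \<xi>)) \<partial>M) < \<infinity>"
    "(\<integral>\<^sup>+\<xi>. ennreal (- real_of_ereal (h \<xi>)) \<partial>M) < \<infinity>"
    using int unfolding real_integrable_def by (auto simp: top.not_eq_extremum)
  show ?thesis
    unfolding ext_expectation_def pos neg *[OF fin(1)] *[OF fin(2)] real_lebesgue_integral_def[OF int]
    by simp
qed

lemma ext_integrable_restrict:
  assumes h: "ext_integrable M h" and S: "{\<xi>\<in>space M. \<xi> \<in> S} \<in> sets M"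
  shows "ext_integrable M (\<lambda>\<xi>. h \<xi> * indicator S \<xi>)"
  unfolding ext_integrable_def
proof
  have [measurable]: "h \<in> borel_measurable M" using h by (simp add: ext_integrable_def)
  have "(\<lambda>\<xi>. if \<xi> \<in> S then h \<xi> else 0) \<in> borel_measurable M"
    using S by (intro measurable_If) auto
  then show "(\<lambda>\<xi>. h \<xi> * indicator S \<xi>) \<in> borel_measurable M"
    by (rule measurable_cong[THEN iffD1, rotated]) (auto simp: indicator_def)
  have "(\<integral>\<^sup>+\<xi>. e2ennreal \<bar>h \<xi> * indicator S \<xi>\<bar> \<partial>M) \<le> (\<integral>\<^sup>+\<xi>. e2ennreal \<bar>h \<xi>\<bar> \<partial>M)"
    by (intro nn_integral_mono) (auto simp: indicator_def e2ennreal_neg)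
  also have "\<dots> < \<infinity>" using h by (simp add: ext_integrable_def)
  finally show "(\<integral>\<^sup>+\<xi>. e2ennreal \<bar>h \<xi> * indicator S \<xi>\<bar> \<partial>M) < \<infinity>" .
qed

text \<open>
  The bounds make the conversion to \<open>real\<close> harmless: for \<open>c \<ge> 0\<close> the clamped value is finite, and the
  map is continuous on all extended reals.
\<close>

definition clamp_real :: "real \<Rightarrow> ereal \<Rightarrow> real" where
  "clamp_real c t = real_of_ereal (max (- ereal c) (min (ereal c) t))"

lemma abs_clamp_real_le: "0 \<le> c \<Longrightarrow> \<bar>clamp_real c t\<bar> \<le> c"
  by (cases t) (auto simp: clamp_real_def min_def max_def)

lemma abs_clamp_real_le_arg: "0 \<le> c \<Longrightarrow> \<bar>t\<bar> \<noteq> \<infinity> \<Longrightarrow> \<bar>clamp_real c t\<bar> \<le> \<bar>real_of_ereal t\<bar>"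
  by (cases t) (auto simp: clamp_real_def min_def max_def)

lemma clamp_real_eq: "\<bar>real_of_ereal t\<bar> \<le> c \<Longrightarrow> \<bar>t\<bar> \<noteq> \<infinity> \<Longrightarrow> clamp_real c t = real_of_ereal t"
  by (cases t) (auto simp: clamp_real_def min_def max_def)

lemma clamp_real_tendsto:
  assumes c: "0 \<le> c" and lim: "(u \<longlongrightarrow> t) F"
  shows "((\<lambda>x. clamp_real c (u x)) \<longlongrightarrow> clamp_real c t) F"
proof -
  have "((\<lambda>x. max (- ereal c) (min (ereal c) (u x))) \<longlongrightarrow> max (- ereal c) (min (ereal c) t)) F"
    by (intro tendsto_max tendsto_min tendsto_const lim)
  moreover have "max (- ereal c) (min (ereal c) t) = ereal (clamp_real c t)"
    using c by (cases t) (auto simp: clamp_real_def min_def max_def)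
  ultimately show ?thesis unfolding clamp_real_def[of c "u _"] by (intro lim_real_of_ereal) simp
qed

lemma measurable_clamp_real:
  "h \<in> borel_measurable M \<Longrightarrow> (\<lambda>\<xi>. clamp_real c (h \<xi>)) \<in> borel_measurable M"
  unfolding clamp_real_def
  by (intro borel_measurable_real_of_ereal borel_measurable_max borel_measurable_min) simp_all

text \<open>
  Clamping lowers a value only where \<open>h \<ge> c\<close>, and there by \<open>h - c \<le> h\<close>; symmetrically it raises a value
  only where \<open>h \<le> -c\<close>. The error is thus bounded by the two tail expectations.
\<close>

lemma (in prob_space) integral_clamp_real_bounds:
  assumes h: "ext_integrable M h" and c: "0 \<le> c"
  shows "ereal (\<integral>\<xi>. real_of_ereal (h \<xi>) \<partial>M) \<le>
      ereal (\<integral>\<xi>. clamp_real c (h \<xi>) \<partial>M) + ext_expectation M (\<lambda>\<xi>. h \<xi> * indicator {\<xi>. ereal c \<le> h \<xi>} \<xi>)"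
    and "ereal (\<integral>\<xi>. clamp_real c (h \<xi>) \<partial>M) + ext_expectation M (\<lambda>\<xi>. h \<xi> * indicator {\<xi>. h \<xi> \<le> ereal (- c)} \<xi>)
      \<le> ereal (\<integral>\<xi>. real_of_ereal (h \<xi>) \<partial>M)"
proof -
  have [measurable]: "h \<in> borel_measurable M" using h by (simp add: ext_integrable_def)
  have "{\<xi>\<in>space M. \<xi> \<in> {\<xi>. ereal c \<le> h \<xi>}} \<in> sets M" "{\<xi>\<in>space M. \<xi> \<in> {\<xi>. h \<xi> \<le> ereal (- c)}} \<in> sets M"
    by simp_all
  note tail = this[THEN ext_integrable_restrict[OF h]]
  note int = ext_integrable_imp_integrable[OF h]
    ext_integrable_imp_integrable[OF tail(1)] ext_integrable_imp_integrable[OF tail(2)]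
  have "(\<lambda>\<xi>. clamp_real c (h \<xi>)) \<in> borel_measurable M" by (intro measurable_clamp_real) measurable
  then have clamp: "integrable M (\<lambda>\<xi>. clamp_real c (h \<xi>))"
    by (intro integrable_const_bound[of _ c]) (use abs_clamp_real_le[OF c] in auto)
  have "(\<integral>\<xi>. real_of_ereal (h \<xi>) \<partial>M) \<le>
      (\<integral>\<xi>. clamp_real c (h \<xi>) + real_of_ereal (h \<xi> * indicator {\<xi>. ereal c \<le> h \<xi>} \<xi>) \<partial>M)"
  proof (rule integral_mono_AE)
    show "AE \<xi> in M. real_of_ereal (h \<xi>) \<le>
        clamp_real c (h \<xi>) + real_of_ereal (h \<xi> * indicator {\<xi>. ereal c \<le> h \<xi>} \<xi>)"
      using ext_integrable_AE_finite[OF h]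
      by eventually_elim (use c in \<open>auto simp: clamp_real_def indicator_def min_def max_def\<close>)
  qed (use int clamp in auto)
  then show "ereal (\<integral>\<xi>. real_of_ereal (h \<xi>) \<partial>M) \<le>
      ereal (\<integral>\<xi>. clamp_real c (h \<xi>) \<partial>M) + ext_expectation M (\<lambda>\<xi>. h \<xi> * indicator {\<xi>. ereal c \<le> h \<xi>} \<xi>)"
    unfolding ext_expectation_eq_integral[OF tail(1)] using int clamp by simp
  have "(\<integral>\<xi>. clamp_real c (h \<xi>) + real_of_ereal (h \<xi> * indicator {\<xi>. h \<xi> \<le> ereal (- c)} \<xi>) \<partial>M)
      \<le> (\<integral>\<xi>. real_of_ereal (h \<xi>) \<partial>M)"
  proof (rule integral_mono_AE)
    show "AE \<xi> in M. clamp_real c (h \<xi>) + real_of_ereal (h \<xi> * indicator {\<xi>. h \<xi> \<le> ereal (- c)} \<xi>)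
        \<le> real_of_ereal (h \<xi>)"
      using ext_integrable_AE_finite[OF h]
      by eventually_elim (use c in \<open>auto simp: clamp_real_def indicator_def min_def max_def\<close>)
  qed (use int clamp in auto)
  then show "ereal (\<integral>\<xi>. clamp_real c (h \<xi>) \<partial>M) + ext_expectation M (\<lambda>\<xi>. h \<xi> * indicator {\<xi>. h \<xi> \<le> ereal (- c)} \<xi>)
      \<le> ereal (\<integral>\<xi>. real_of_ereal (h \<xi>) \<partial>M)"
    unfolding ext_expectation_eq_integral[OF tail(2)] using int clamp by simp
qed

lemma (in prob_space) integral_clamp_real_tendsto:
  assumes h: "ext_integrable M h"
  shows "(\<lambda>k. \<integral>\<xi>. clamp_real (real k) (h \<xi>) \<partial>M) \<longlonglongrightarrow> (\<integral>\<xi>. real_of_ereal (h \<xi>) \<partial>M)"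
proof (rule integral_dominated_convergence[where w = "\<lambda>\<xi>. \<bar>real_of_ereal (h \<xi>)\<bar>"])
  have m: "h \<in> borel_measurable M" using h by (simp add: ext_integrable_def)
  show "(\<lambda>\<xi>. real_of_ereal (h \<xi>)) \<in> borel_measurable M"
    "integrable M (\<lambda>\<xi>. \<bar>real_of_ereal (h \<xi>)\<bar>)"
    using ext_integrable_imp_integrable[OF h] by (auto simp del: abs_real_of_ereal)
  show "(\<lambda>\<xi>. clamp_real (real k) (h \<xi>)) \<in> borel_measurable M" for k
    by (rule measurable_clamp_real[OF m])
  show "AE \<xi> in M. norm (clamp_real (real k) (h \<xi>)) \<le> \<bar>real_of_ereal (h \<xi>)\<bar>" for k
    using ext_integrable_AE_finite[OF h] by eventually_elim (simp add: abs_clamp_real_le_arg del: abs_real_of_ereal)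
  show "AE \<xi> in M. (\<lambda>k. clamp_real (real k) (h \<xi>)) \<longlonglongrightarrow> real_of_ereal (h \<xi>)"
    using ext_integrable_AE_finite[OF h]
  proof eventually_elim
    case (elim \<xi>)
    obtain N :: nat where N: "\<bar>real_of_ereal (h \<xi>)\<bar> \<le> real N" using real_arch_simple by blast
    have "clamp_real (real k) (h \<xi>) = real_of_ereal (h \<xi>)" if "N \<le> k" for k
      using N that elim by (intro clamp_real_eq) auto
    then show ?case by (intro tendsto_eventually) (auto simp: eventually_sequentially)
  qed
qed

text \<open>
  The limit theorem behind the consistency of the Bellman operators. The tail conditions replace
  uniform integrability: at a fixed clamping level \<open>c = k\<close> the clamped expectations converge by weak
  convergence, and the level is chosen so that all clamping errors are below \<open>e / 3\<close>.
\<close>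

lemma ext_expectation_tendsto:
  fixes \<Xi> :: "'b::euclidean_space set" and gs :: "nat \<Rightarrow> 'b \<Rightarrow> ereal"
  assumes \<Xi>: "closed \<Xi>" and P: "borel_distribution \<Xi> P" and Ps: "\<And>\<nu>. borel_distribution \<Xi> (Ps \<nu>)"
    and weak: "weak_conv_on \<Xi> Ps P"
    and int: "\<And>\<nu>. ext_integrable (Ps \<nu>) (gs \<nu>)" "ext_integrable P g"
    and cc: "cont_conv \<Xi> gs g"
    and lower: "\<And>e. 0 < e \<Longrightarrow> \<forall>\<^sub>F \<tau> in at_bot. \<forall>\<^sub>F \<nu> in sequentially.
        ereal (- e) < ext_expectation (Ps \<nu>) (\<lambda>\<xi>. gs \<nu> \<xi> * indicator {\<xi>. gs \<nu> \<xi> \<le> ereal \<tau>} \<xi>)"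
    and upper: "\<And>e. 0 < e \<Longrightarrow> \<forall>\<^sub>F \<tau> in at_top. \<forall>\<^sub>F \<nu> in sequentially.
        ext_expectation (Ps \<nu>) (\<lambda>\<xi>. gs \<nu> \<xi> * indicator {\<xi>. ereal \<tau> \<le> gs \<nu> \<xi>} \<xi>) < ereal e"
  shows "(\<lambda>\<nu>. ext_expectation (Ps \<nu>) (gs \<nu>)) \<longlonglongrightarrow> ext_expectation P g"
proof -
  let ?E = "\<lambda>\<nu>. \<integral>\<xi>. real_of_ereal (gs \<nu> \<xi>) \<partial>Ps \<nu>" and ?L = "\<integral>\<xi>. real_of_ereal (g \<xi>) \<partial>P"
  interpret P: prob_space P using P by (simp add: borel_distribution_def)
  have "?E \<longlonglongrightarrow> ?L"
  proof (rule tendstoI)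
    fix e :: real assume "0 < e"
    then have e: "0 < e / 3" by simp
    have top: "filterlim real at_top sequentially" by (rule filterlim_real_sequentially)
    have bot: "filterlim (\<lambda>k. - real k) at_bot sequentially"
      using top by (simp add: filterlim_uminus_at_bot)
    have "\<forall>\<^sub>F k in sequentially. \<bar>(\<integral>\<xi>. clamp_real (real k) (g \<xi>) \<partial>P) - ?L\<bar> < e / 3"
      using tendstoD[OF P.integral_clamp_real_tendsto[OF int(2)] e] by (simp add: dist_real_def)
    with eventually_compose_filterlim[OF lower[OF e] bot] eventually_compose_filterlim[OF upper[OF e] top]
    have "\<forall>\<^sub>F k in sequentially. \<bar>(\<integral>\<xi>. clamp_real (real k) (g \<xi>) \<partial>P) - ?L\<bar> < e / 3 \<and>
        (\<forall>\<^sub>F \<nu> in sequentially. ereal (- (e / 3)) <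
          ext_expectation (Ps \<nu>) (\<lambda>\<xi>. gs \<nu> \<xi> * indicator {\<xi>. gs \<nu> \<xi> \<le> ereal (- real k)} \<xi>)) \<and>
        (\<forall>\<^sub>F \<nu> in sequentially.
          ext_expectation (Ps \<nu>) (\<lambda>\<xi>. gs \<nu> \<xi> * indicator {\<xi>. ereal (real k) \<le> gs \<nu> \<xi>} \<xi>) < ereal (e / 3))"
      by eventually_elim blast
    then obtain k :: nat where k: "\<bar>(\<integral>\<xi>. clamp_real (real k) (g \<xi>) \<partial>P) - ?L\<bar> < e / 3"
      and lo: "\<forall>\<^sub>F \<nu> in sequentially. ereal (- (e / 3)) <
          ext_expectation (Ps \<nu>) (\<lambda>\<xi>. gs \<nu> \<xi> * indicator {\<xi>. gs \<nu> \<xi> \<le> ereal (- real k)} \<xi>)"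
      and up: "\<forall>\<^sub>F \<nu> in sequentially.
          ext_expectation (Ps \<nu>) (\<lambda>\<xi>. gs \<nu> \<xi> * indicator {\<xi>. ereal (real k) \<le> gs \<nu> \<xi>} \<xi>) < ereal (e / 3)"
      unfolding eventually_sequentially by blast
    have "cont_conv \<Xi> (\<lambda>\<nu> \<xi>. clamp_real (real k) (gs \<nu> \<xi>)) (\<lambda>\<xi>. clamp_real (real k) (g \<xi>))"
      using cc unfolding cont_conv_def case_prod_unfold by (auto intro: clamp_real_tendsto)
    then have "(\<lambda>\<nu>. \<integral>\<xi>. clamp_real (real k) (gs \<nu> \<xi>) \<partial>Ps \<nu>) \<longlonglongrightarrow> (\<integral>\<xi>. clamp_real (real k) (g \<xi>) \<partial>P)"
      by (rule weak_conv_on_cont_conv_integral[OF \<Xi> P Ps weak _ abs_clamp_real_le abs_clamp_real_le, rotated -1])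
        (use int in \<open>auto simp: ext_integrable_def intro!: measurable_clamp_real\<close>)
    from tendstoD[OF this e] lo up show "\<forall>\<^sub>F \<nu> in sequentially. dist (?E \<nu>) ?L < e"
    proof eventually_elim
      case (elim \<nu>)
      interpret prob_space "Ps \<nu>" using Ps by (simp add: borel_distribution_def)
      let ?c = "\<integral>\<xi>. clamp_real (real k) (gs \<nu> \<xi>) \<partial>Ps \<nu>"
      have "ereal (?E \<nu>) \<le> ereal ?c + ereal (e / 3)"
        by (rule order_trans[OF integral_clamp_real_bounds(1)[OF int(1)[of \<nu>], of "real k"] add_left_mono])
          (use elim(3) in auto)
      moreover have "ereal ?c + ereal (- (e / 3)) \<le> ereal (?E \<nu>)"
        by (rule order_trans[OF add_left_mono integral_clamp_real_bounds(2)[OF int(1)[of \<nu>], of "real k"]])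
          (use elim(2) in auto)
      ultimately have "?E \<nu> \<le> ?c + e / 3" "?c - e / 3 \<le> ?E \<nu>" by simp_all
      then show ?case using k elim(1) unfolding dist_real_def by linarith
    qed
  qed
  then show ?thesis by (simp add: ext_expectation_eq_integral int)
qed

section \<open>Outer limits of fixed points\<close>

theorem theorem2:
  fixes X :: "(real^'n) set"
    and \<Xi> :: "(real^'m) set"
    and \<beta> :: real
    and Y :: "real^'n \<Rightarrow> real^'m \<Rightarrow> (real^'n) set"
    and \<phi> :: "(real^'n) \<times> (real^'n) \<times> (real^'m) \<Rightarrow> real"
    and \<phi>s :: "nat \<Rightarrow> (real^'n) \<times> (real^'n) \<times> (real^'m) \<Rightarrow> real"
    and P :: "(real^'m) measure"
    and Ps :: "nat \<Rightarrow> (real^'m) measure"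
    and zctr :: "(real^'n) \<times> real"
    and \<V> :: "(real^'n \<Rightarrow> ereal) set"
  assumes "closed X" and "closed \<Xi>"
    and "0 < \<beta>" and "\<beta> < 1"
    and "\<And>x \<xi>. x \<in> X \<Longrightarrow> \<xi> \<in> \<Xi> \<Longrightarrow> Y x \<xi> \<subseteq> X \<and> Y x \<xi> \<noteq> {} \<and> compact (Y x \<xi>)"
    and "borel_distribution \<Xi> P" and "\<And>\<nu>. borel_distribution \<Xi> (Ps \<nu>)"
    and "zctr \<in> X \<times> UNIV"
    and "\<V> \<subseteq> lsc_fcns X"
    and "bellman_regular X Y \<beta> \<phi> P \<V>"
    and "\<And>\<nu>. bellman_regular X Y \<beta> (\<phi>s \<nu>) (Ps \<nu>) \<V>"
    and "weak_conv_on \<Xi> Ps P"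
    and "epi_conv (X \<times> X \<times> \<Xi>) (\<lambda>\<nu> z. ereal (\<phi>s \<nu> z)) (\<lambda>z. ereal (\<phi> z))"
    and "\<And>z. z \<in> X \<times> X \<times> \<Xi> \<Longrightarrow> (\<lambda>\<nu>. \<phi>s \<nu> z) \<longlonglongrightarrow> \<phi> z"
    and "closedin (AW_topology zctr X (lsc_fcns X)) \<V>"
    and "\<And>Vs U. (\<And>\<nu>. Vs \<nu> \<in> \<V>) \<Longrightarrow> U \<in> fcns X \<Longrightarrow> epi_conv X Vs U \<Longrightarrow> equi_lsc X Vs"
    and "\<And>Vs U x0. (\<And>\<nu>. Vs \<nu> \<in> \<V>) \<Longrightarrow> U \<in> fcns X \<Longrightarrow> epi_conv X Vs U \<Longrightarrow> x0 \<in> X \<Longrightarrow>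
       Liminf at_bot (\<lambda>\<tau>::real. Liminf (sequentially \<times>\<^sub>F inf (nhds x0) (principal X)) (\<lambda>(\<nu>, x).
         ext_expectation (Ps \<nu>) (\<lambda>\<xi>. bellman_b Y \<beta> (\<phi>s \<nu>) (Vs \<nu>) (x, \<xi>) *
           indicator {\<xi>. bellman_b Y \<beta> (\<phi>s \<nu>) (Vs \<nu>) (x, \<xi>) \<le> ereal \<tau>} \<xi>))) = 0 \<and>
       (\<forall>\<nu>. lsc_on (X \<times> \<Xi>) (bellman_b Y \<beta> (\<phi>s \<nu>) (Vs \<nu>))) \<and>
       equi_lsc (X \<times> \<Xi>) (\<lambda>\<nu>. bellman_b Y \<beta> (\<phi>s \<nu>) (Vs \<nu>))"
    and "\<And>Vs U x0. (\<And>\<nu>. Vs \<nu> \<in> \<V>) \<Longrightarrow> U \<in> fcns X \<Longrightarrow> epi_conv X Vs U \<Longrightarrow> x0 \<in> X \<Longrightarrow>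
       Limsup at_top (\<lambda>\<tau>::real. limsup (\<lambda>\<nu>.
         ext_expectation (Ps \<nu>) (\<lambda>\<xi>. bellman_b Y \<beta> (\<phi>s \<nu>) (Vs \<nu>) (x0, \<xi>) *
           indicator {\<xi>. bellman_b Y \<beta> (\<phi>s \<nu>) (Vs \<nu>) (x0, \<xi>) \<ge> ereal \<tau>} \<xi>))) = 0 \<and>
       (\<forall>\<nu>. usc_on \<Xi> (\<lambda>\<xi>. bellman_b Y \<beta> (\<phi>s \<nu>) (Vs \<nu>) (x0, \<xi>))) \<and>
       equi_usc \<Xi> (\<lambda>\<nu> \<xi>. bellman_b Y \<beta> (\<phi>s \<nu>) (Vs \<nu>) (x0, \<xi>))"
  shows "LimOut (AW_topology zctr X \<V>) (\<lambda>\<nu>. bellman_fixed zctr X (bellman_B X Y \<beta> (\<phi>s \<nu>) (Ps \<nu>)) \<V>)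
           \<subseteq> bellman_fixed zctr X (bellman_B X Y \<beta> \<phi> P) \<V> \<and>
    (compactin (AW_topology zctr X (lsc_fcns X)) \<V> \<longrightarrow>
      (\<forall>Vs. (\<forall>\<nu>. Vs \<nu> \<in> bellman_fixed zctr X (bellman_B X Y \<beta> (\<phi>s \<nu>) (Ps \<nu>)) \<V>) \<longrightarrow>
        (\<forall>W. cluster_point (AW_topology zctr X (lsc_fcns X)) Vs W \<longrightarrow>
             W \<in> bellman_fixed zctr X (bellman_B X Y \<beta> \<phi> P) \<V>) \<and>
        bellman_fixed zctr X (bellman_B X Y \<beta> \<phi> P) \<V> \<noteq> {}))"
proof -
  note X = assms(1) and \<Xi> = assms(2) and \<beta> = assms(3) and Y = assms(5)
    and P = assms(6) and Ps = assms(7) and zctr = assms(8) and V_lsc = assms(9)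
    and reg = assms(10) and regs = assms(11) and weak = assms(12)
    and \<phi>epi = assms(13) and \<phi>lim = assms(14) and V_closed = assms(15)
    and V_equi = assms(16) and cond_i = assms(17) and cond_ii = assms(18)
  let ?d = "AW_dist zctr X" and ?T = "AW_topology zctr X (lsc_fcns X)"
  let ?B = "bellman_B X Y \<beta> \<phi> P" and ?Bs = "\<lambda>\<nu>. bellman_B X Y \<beta> (\<phi>s \<nu>) (Ps \<nu>)"
  interpret Submetric "lsc_fcns X" ?d \<V>
    using Metric_space_AW_dist[OF X zctr] V_lsc by (simp add: Submetric_def Submetric_axioms_def)
  have fixed_iff: "V \<in> bellman_fixed zctr X B \<V> \<longleftrightarrow> V \<in> \<V> \<and> B V = V"
    if "V \<in> \<V> \<Longrightarrow> B V \<in> \<V>" for V B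
  proof (cases "V \<in> \<V>")
    case True
    then have "?d V (B V) = 0 \<longleftrightarrow> V = B V" using that V_lsc by (intro zero) auto
    with True show ?thesis by (auto simp: bellman_fixed_def)
  qed (simp add: bellman_fixed_def)
  have B_in: "?B V \<in> \<V>" "?Bs \<nu> V \<in> \<V>" if "V \<in> \<V>" for V \<nu>
    using reg regs that unfolding bellman_regular_def by auto
  \<comment> \<open>Consistency of the operators: if members of \<open>\<V>\<close> converge to \<open>W\<close>, then so do their values, and their
      images under the approximating operators converge pointwise to \<open>B W\<close>.\<close>
  have key: "(\<lambda>\<nu>. Vs \<nu> x) \<longlonglongrightarrow> W x \<and> (\<lambda>\<nu>. ?Bs \<nu> (Vs \<nu>) x) \<longlonglongrightarrow> ?B W x"
    if Vs: "\<And>\<nu>. Vs \<nu> \<in> \<V>" and W: "W \<in> \<V>" and conv: "(\<lambda>\<nu>. ?d (Vs \<nu>) W) \<longlonglongrightarrow> 0" and x: "x \<in> X"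
    for Vs W x
  proof
    have Vs_lsc: "Vs \<nu> \<in> lsc_fcns X" and W_lsc: "W \<in> lsc_fcns X" for \<nu>
      using Vs W V_lsc by auto
    then have W_fcn: "W \<in> fcns X" by (simp add: lsc_fcns_def)
    have epi: "epi_conv X Vs W" by (rule AW_conv_imp_epi_conv[OF X zctr Vs_lsc W_lsc conv])
    have pw: "(\<lambda>\<nu>. Vs \<nu> y) \<longlonglongrightarrow> W y" if "y \<in> X" for y
      by (rule epi_conv_equi_lsc_tendsto[OF epi V_equi[OF Vs W_fcn epi] that])
    then show "(\<lambda>\<nu>. Vs \<nu> x) \<longlonglongrightarrow> W x" using x .
    note i = cond_i[OF Vs W_fcn epi x] and ii = cond_ii[OF Vs W_fcn epi x]
    define gs where "gs \<nu> \<xi> = bellman_b Y \<beta> (\<phi>s \<nu>) (Vs \<nu>) (x, \<xi>)" for \<nu> \<xi>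
    define g where "g \<xi> = bellman_b Y \<beta> \<phi> W (x, \<xi>)" for \<xi>
    have "equi_lsc \<Xi> gs"
      unfolding gs_def by (rule equi_lsc_section[OF conjunct2[OF conjunct2[OF i]] x])
    moreover have "equi_usc \<Xi> gs" unfolding gs_def using ii by blast
    moreover have "(\<lambda>\<nu>. gs \<nu> \<xi>) \<longlonglongrightarrow> g \<xi>" if "\<xi> \<in> \<Xi>" for \<xi>
      unfolding gs_def g_def
      by (rule bellman_b_tendsto[OF \<beta> _ _ x that \<phi>epi \<phi>lim epi pw]) (use Y[OF x that] in auto)
    ultimately have cc: "cont_conv \<Xi> gs g" by (rule equi_semicont_cont_conv)
    have "(\<lambda>\<nu>. ext_expectation (Ps \<nu>) (gs \<nu>)) \<longlonglongrightarrow> ext_expectation P g"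
    proof (rule ext_expectation_tendsto[OF \<Xi> P Ps weak _ _ cc])
      show "ext_integrable (Ps \<nu>) (gs \<nu>)" for \<nu>
        using regs Vs x unfolding bellman_regular_def gs_def by blast
      show "ext_integrable P g" using reg W x unfolding bellman_regular_def g_def by blast
      fix e :: real assume e: "0 < e"
      have "\<forall>\<^sub>F \<tau> in at_bot. ereal (- e) < Liminf (jointly_at X x) (\<lambda>(\<nu>, x).
          ext_expectation (Ps \<nu>) (\<lambda>\<xi>. bellman_b Y \<beta> (\<phi>s \<nu>) (Vs \<nu>) (x, \<xi>) *
            indicator {\<xi>. bellman_b Y \<beta> (\<phi>s \<nu>) (Vs \<nu>) (x, \<xi>) \<le> ereal \<tau>} \<xi>))"
        by (rule less_LiminfD) (use i e in simp)
      then show "\<forall>\<^sub>F \<tau> in at_bot. \<forall>\<^sub>F \<nu> in sequentially.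
          ereal (- e) < ext_expectation (Ps \<nu>) (\<lambda>\<xi>. gs \<nu> \<xi> * indicator {\<xi>. gs \<nu> \<xi> \<le> ereal \<tau>} \<xi>)"
      proof eventually_elim
        case (elim \<tau>)
        from eventually_jointly_at_center[OF less_LiminfD[OF elim] x] show ?case by (simp add: gs_def)
      qed
      have "\<forall>\<^sub>F \<tau> in at_top. limsup (\<lambda>\<nu>.
          ext_expectation (Ps \<nu>) (\<lambda>\<xi>. gs \<nu> \<xi> * indicator {\<xi>. ereal \<tau> \<le> gs \<nu> \<xi>} \<xi>)) < ereal e"
        by (rule Limsup_lessD) (use ii e in \<open>simp add: gs_def\<close>)
      then show "\<forall>\<^sub>F \<tau> in at_top. \<forall>\<^sub>F \<nu> in sequentially.
          ext_expectation (Ps \<nu>) (\<lambda>\<xi>. gs \<nu> \<xi> * indicator {\<xi>. ereal \<tau> \<le> gs \<nu> \<xi>} \<xi>) < ereal e"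
        by eventually_elim (rule Limsup_lessD)
    qed
    then show "(\<lambda>\<nu>. ?Bs \<nu> (Vs \<nu>) x) \<longlonglongrightarrow> ?B W x"
      using x by (simp add: bellman_B_def gs_def[abs_def] g_def[abs_def])
  qed
  have outer: "LimOut sub.mtopology (\<lambda>\<nu>. bellman_fixed zctr X (?Bs \<nu>) \<V>) \<subseteq> bellman_fixed zctr X ?B \<V>"
  proof
    fix W assume "W \<in> LimOut sub.mtopology (\<lambda>\<nu>. bellman_fixed zctr X (?Bs \<nu>) \<V>)"
    then obtain r zs where r: "strict_mono r"
      and zs: "\<And>k. zs k \<in> bellman_fixed zctr X (?Bs (r k)) \<V>" and lim: "limitin sub.mtopology zs W sequentially"
      unfolding LimOut_def by blast
    have W: "W \<in> \<V>" and dist: "(\<lambda>k. ?d (zs k) W) \<longlonglongrightarrow> 0"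
      using lim unfolding sub.limitin_metric_dist_null by auto
    have zV: "zs k \<in> \<V>" and zfix: "?Bs (r k) (zs k) = zs k" for k
      using zs[of k] fixed_iff[of "zs k" "?Bs (r k)", OF B_in(2)] by blast+
    \<comment> \<open>The equi-semicontinuity and tail hypotheses concern full sequences in \<open>\<V>\<close>.\<close>
    let ?Vs = "fill r zs W"
    have Vs: "?Vs \<nu> \<in> \<V>" for \<nu> using zV W by (rule fill_in)
    have "(\<lambda>\<nu>. ?d (?Vs \<nu>) W) \<longlonglongrightarrow> 0"
    proof (rule tendstoI)
      fix e :: real assume "0 < e"
      then show "\<forall>\<^sub>F \<nu> in sequentially. dist (?d (?Vs \<nu>) W) 0 < e"
        using tendstoD[OF dist] W V_lsc
        by (intro eventually_fill[OF r, where Q = "\<lambda>V. dist (?d V W) 0 < e"]) auto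
    qed
    note lims = key[OF Vs W this]
    have "W x = ?B W x" if x: "x \<in> X" for x
    proof (rule LIMSEQ_unique)
      show "(\<lambda>k. zs k x) \<longlonglongrightarrow> W x"
        using LIMSEQ_subseq_LIMSEQ[OF conjunct1[OF lims[OF x]] r] by (simp add: o_def fill_at[OF r])
      show "(\<lambda>k. zs k x) \<longlonglongrightarrow> ?B W x"
        using LIMSEQ_subseq_LIMSEQ[OF conjunct2[OF lims[OF x]] r] by (simp add: o_def fill_at[OF r] zfix)
    qed
    moreover have "W \<in> extensional X" "?B W \<in> extensional X"
      using W B_in(1)[OF W] V_lsc by (auto simp: lsc_fcns_def fcns_def)
    ultimately have "?B W = W" by (intro extensionalityI[of _ X]) auto
    then show "W \<in> bellman_fixed zctr X ?B \<V>" using fixed_iff[of W ?B, OF B_in(1)] W by blast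
  qed
  have cluster: "W \<in> bellman_fixed zctr X ?B \<V>"
    if Vs: "\<And>\<nu>. Vs \<nu> \<in> bellman_fixed zctr X (?Bs \<nu>) \<V>" and W: "cluster_point ?T Vs W" for Vs W
  proof -
    obtain r where r: "strict_mono r" and lim: "limitin ?T (Vs \<circ> r) W sequentially"
      using W unfolding cluster_point_def by blast
    have in_V: "\<forall>\<^sub>F k in sequentially. (Vs \<circ> r) k \<in> \<V>"
      using Vs by (intro always_eventually) (auto simp: bellman_fixed_def)
    have "W \<in> \<V>" by (rule limitin_closedin[OF lim V_closed in_V]) simp
    then have "limitin sub.mtopology (Vs \<circ> r) W sequentially"
      using in_V lim by (simp add: limitin_submetric_iff)
    moreover have "\<forall>k. (Vs \<circ> r) k \<in> bellman_fixed zctr X (?Bs (r k)) \<V>" using Vs by simp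
    ultimately have "W \<in> LimOut sub.mtopology (\<lambda>\<nu>. bellman_fixed zctr X (?Bs \<nu>) \<V>)"
      unfolding LimOut_def using r by (intro CollectI exI[of _ r] exI[of _ "Vs \<circ> r"] conjI)
    then show ?thesis using outer by blast
  qed
  have "bellman_fixed zctr X ?B \<V> \<noteq> {}"
    if "compactin ?T \<V>" and Vs: "\<And>\<nu>. Vs \<nu> \<in> bellman_fixed zctr X (?Bs \<nu>) \<V>" for Vs
  proof -
    have "range Vs \<subseteq> \<V>" using Vs by (auto simp: bellman_fixed_def)
    with conjunct2[OF that(1)[unfolded compactin_sequentially]]
    have "\<exists>W r. W \<in> \<V> \<and> strict_mono r \<and> limitin ?T (Vs \<circ> r) W sequentially" by simp
    then obtain W r where "strict_mono r" "limitin ?T (Vs \<circ> r) W sequentially" by (elim exE conjE)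
    then have "cluster_point ?T Vs W" unfolding cluster_point_def by (intro exI[of _ r] conjI)
    from cluster[OF Vs this] show ?thesis by blast
  qed
  note nonempty = this
  show ?thesis
  proof (intro conjI impI allI)
    fix Vs W assume "compactin ?T \<V>" and Vs: "\<forall>\<nu>. Vs \<nu> \<in> bellman_fixed zctr X (?Bs \<nu>) \<V>"
    show "bellman_fixed zctr X ?B \<V> \<noteq> {}"
      by (rule nonempty[OF \<open>compactin ?T \<V>\<close> spec[OF Vs]])
    assume "cluster_point ?T Vs W"
    then show "W \<in> bellman_fixed zctr X ?B \<V>" by (rule cluster[OF spec[OF Vs]])
  qed (rule outer)
qed

end
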